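(* Let $p$ be a prime and let $U$ be a finite $p$-group acting by ring automorphisms on a ring $R$. Let $x\in R$ satisfy $N_U(x)=1$ and let $\beta:U\to R$ be a $1$-cocycle. The following inductive procedure, on the order of $U$ and starting from cyclic groups of order $p$, constructs explicitly an element $w\in R$ such that $$\beta(g)=(g-1)w\quad\text{for all } g\in U,$$ with $w$ expressed as a noncommutative polynomial with integer coefficients in the variables $u(x)$ and $u(\beta(v))$, where $u,v\in U$. (1) If $U$ is cyclic of order $p$ with generator $\sigma$, take $$w=\sum_{k=1}^{p-1}(1+\sigma+\cdots+\sigma^{k-1})\bigl(x\,\sigma^{-k}\beta(\sigma)\bigr).$$ (2) In general, fix a normal subgroup $U'$ of $U$ of index $p$ and an element $\sigma\in U$ whose class generates $U/U'$. The element $x'=(1+\sigma+\cdots+\sigma^{p-1})(x)$ satisfies $N_{U'}(x')=1$. By induction one has an element $w_1\in R$, expressed as a noncommutative polynomial with integer coefficients in the $u'(x')$ and $u'(\beta(v'))$ ($u',v'\in U'$), such that $\beta(g)=(g-1)w_1$ for all $g\in U'$. The element $s'=\beta(\sigma)-(\sigma-1)w_1$ is $U'$-invariant and satisfies $(1+\sigma+\cdots+\sigma^{p-1})s'=0$, and the element $x''=N_{U'}(x)$ is $U'$-invariant and satisfies $(1+\sigma+\cdots+\sigma^{p-1})x''=1$. Put $$w_2=\sum_{k=1}^{p-1}(1+\sigma+\cdots+\sigma^{k-1})\bigl(x''\,\sigma^{-k}(s')\bigr),$$ which is a $U'$-invariant element with $s'=(\sigma-1)w_2$. Then take $w=w_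1+w_2$.
   Context: Rings are associative with unit, not necessarily commutative. For a finite group $V$ acting on $R$ by ring automorphisms, $N_V(r)=\sum_{g\in V}g(r)$. The action is extended additively to an action of the integral group ring. A $1$-cocycle of $U$ with values in $R$ is a map $\beta:U\to R$ with $\beta(gh)=\beta(g)+g\beta(h)$ for all $g,h\in U$. *)

theory Defs
  imports "HOL-Algebra.Algebra" "HOL-Library.Poly_Mapping"
begin

text \<open>The library's \<^locale>\<open>group_action\<close> asks every \<open>\<phi> g\<close> to be extensional on the carrier of \<open>R\<close>;
  this only fixes junk values outside the carrier.\<close>

definition ring_automorphism_action ::
    "('g, 'm) monoid_scheme \<Rightarrow> ('r, 'k) ring_scheme \<Rightarrow> ('g \<Rightarrow> 'r \<Rightarrow> 'r) \<Rightarrow> bool" where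
  "ring_automorphism_action U R \<phi> \<longleftrightarrow>
     group_action U (carrier R) \<phi> \<and> (\<forall>g \<in> carrier U. \<phi> g \<in> ring_iso R R)"

definition action_norm :: "('r, 'k) ring_scheme \<Rightarrow> ('g \<Rightarrow> 'r \<Rightarrow> 'r) \<Rightarrow> 'g set \<Rightarrow> 'r \<Rightarrow> 'r" where
  "action_norm R \<phi> V r = (\<Oplus>\<^bsub>R\<^esub>g \<in> V. \<phi> g r)"

definition one_cocycle ::
    "('g, 'm) monoid_scheme \<Rightarrow> ('r, 'k) ring_scheme \<Rightarrow> ('g \<Rightarrow> 'r \<Rightarrow> 'r) \<Rightarrow> ('g \<Rightarrow> 'r) \<Rightarrow> bool" where
  "one_cocycle U R \<phi> \<beta> \<longleftrightarrow>
     \<beta> \<in> carrier U \<rightarrow> carrier R \<and>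
     (\<forall>g \<in> carrier U. \<forall>h \<in> carrier U. \<beta> (g \<otimes>\<^bsub>U\<^esub> h) = \<beta> g \<oplus>\<^bsub>R\<^esub> \<phi> g (\<beta> h))"

definition cocycle_data ::
    "('g, 'm) monoid_scheme \<Rightarrow> ('r, 'k) ring_scheme \<Rightarrow> ('g \<Rightarrow> 'r \<Rightarrow> 'r) \<Rightarrow> 'r \<Rightarrow> ('g \<Rightarrow> 'r) \<Rightarrow> bool" where
  "cocycle_data U R \<phi> x \<beta> \<longleftrightarrow>
     ring R \<and> ring_automorphism_action U R \<phi> \<and>
     x \<in> carrier R \<and> action_norm R \<phi> (carrier U) x = \<one>\<^bsub>R\<^esub> \<and>
     one_cocycle U R \<phi> \<beta>"

definition action_invariants :: "('r, 'k) ring_scheme \<Rightarrow> ('g \<Rightarrow> 'r \<Rightarrow> 'r) \<Rightarrow> 'g set \<Rightarrow> 'r set" where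
  "action_invariants R \<phi> V = {r \<in> carrier R. \<forall>g \<in> V. \<phi> g r = r}"

text \<open>The action of \<open>1 + \<sigma> + \<dots> + \<sigma>\<^sup>k\<^sup>-\<^sup>1\<close> in the integral group ring.\<close>

definition geometric_action ::
    "('g, 'm) monoid_scheme \<Rightarrow> ('r, 'k) ring_scheme \<Rightarrow> ('g \<Rightarrow> 'r \<Rightarrow> 'r) \<Rightarrow> 'g \<Rightarrow> nat \<Rightarrow> 'r \<Rightarrow> 'r" where
  "geometric_action U R \<phi> \<sigma> k r = (\<Oplus>\<^bsub>R\<^esub>i \<in> {..<k}. \<phi> (\<sigma> [^]\<^bsub>U\<^esub> i) r)"

definition cyclic_solution ::
    "nat \<Rightarrow> ('g, 'm) monoid_scheme \<Rightarrow> ('r, 'k) ring_scheme \<Rightarrow> ('g \<Rightarrow> 'r \<Rightarrow> 'r) \<Rightarrow> 'g \<Rightarrow> 'r \<Rightarrow> 'r \<Rightarrow> 'r" where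
  "cyclic_solution p U R \<phi> \<sigma> y s =
     (\<Oplus>\<^bsub>R\<^esub>k \<in> {1..p - 1}.
        geometric_action U R \<phi> \<sigma> k (y \<otimes>\<^bsub>R\<^esub> \<phi> (inv\<^bsub>U\<^esub> (\<sigma> [^]\<^bsub>U\<^esub> k)) s))"

text \<open>A record of the choices made in one run of the procedure: a generator in the case of order
  \<open>p\<close>, and otherwise the pair \<open>(U', \<sigma>)\<close> together with the choices made for \<open>U'\<close>.\<close>

datatype 'g choices = Cyclic 'g | Extend "'g set" 'g "'g choices"

definition index_p_extension :: "nat \<Rightarrow> ('g, 'm) monoid_scheme \<Rightarrow> 'g set \<Rightarrow> 'g \<Rightarrow> bool" where
  "index_p_extension p U U' \<sigma> \<longleftrightarrow>
     U' \<lhd> U \<and> card (rcosets\<^bsub>U\<^esub> U') = p \<and> \<sigma> \<in> carrier U \<and>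
     generate (U Mod U') {U' #>\<^bsub>U\<^esub> \<sigma>} = carrier (U Mod U')"

primrec admissible :: "nat \<Rightarrow> ('g, 'm) monoid_scheme \<Rightarrow> 'g choices \<Rightarrow> bool" where
  "admissible p U (Cyclic \<sigma>) \<longleftrightarrow>
     order U = p \<and> \<sigma> \<in> carrier U \<and> generate U {\<sigma>} = carrier U"
| "admissible p U (Extend U' \<sigma> c) \<longleftrightarrow>
     index_p_extension p U U' \<sigma> \<and> admissible p (U\<lparr>carrier := U'\<rparr>) c"

primrec procedure ::
    "nat \<Rightarrow> ('g, 'm) monoid_scheme \<Rightarrow> ('r, 'k) ring_scheme \<Rightarrow> ('g \<Rightarrow> 'r \<Rightarrow> 'r) \<Rightarrow>
     'g choices \<Rightarrow> 'r \<Rightarrow> ('g \<Rightarrow> 'r) \<Rightarrow> 'r" where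
  "procedure p U R \<phi> (Cyclic \<sigma>) x \<beta> = cyclic_solution p U R \<phi> \<sigma> x (\<beta> \<sigma>)"
| "procedure p U R \<phi> (Extend U' \<sigma> c) x \<beta> =
     (let x' = geometric_action U R \<phi> \<sigma> p x;
          w\<^sub>1 = procedure p (U\<lparr>carrier := U'\<rparr>) R \<phi> c x' \<beta>;
          s' = \<beta> \<sigma> \<ominus>\<^bsub>R\<^esub> (\<phi> \<sigma> w\<^sub>1 \<ominus>\<^bsub>R\<^esub> w\<^sub>1);
          x'' = action_norm R \<phi> U' x;
          w\<^sub>2 = cyclic_solution p U R \<phi> \<sigma> x'' s'
      in w\<^sub>1 \<oplus>\<^bsub>R\<^esub> w\<^sub>2)"

text \<open>Noncommutative polynomials with integer coefficients are finitely supported functions from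
  words to the integers. The variable \<open>XVar u\<close> stands for \<open>u(x)\<close>, and \<open>BVar u v\<close> for \<open>u(\<beta>(v))\<close>.\<close>

datatype 'g var = XVar 'g | BVar 'g 'g

type_synonym 'g ncpoly = "'g var list \<Rightarrow>\<^sub>0 int"

definition ncpolys_over :: "'g set \<Rightarrow> 'g ncpoly set" where
  "ncpolys_over V =
     {P. \<forall>m \<in> Poly_Mapping.keys P. set m \<subseteq> XVar ` V \<union> {BVar u v |u v. u \<in> V \<and> v \<in> V}}"

primrec var_value :: "('g \<Rightarrow> 'r \<Rightarrow> 'r) \<Rightarrow> 'r \<Rightarrow> ('g \<Rightarrow> 'r) \<Rightarrow> 'g var \<Rightarrow> 'r" where
  "var_value \<phi> x \<beta> (XVar u) = \<phi> u x"
| "var_value \<phi> x \<beta> (BVar u v) = \<phi> u (\<beta> v)"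

definition ncpoly_value ::
    "('r, 'k) ring_scheme \<Rightarrow> ('g \<Rightarrow> 'r \<Rightarrow> 'r) \<Rightarrow> 'r \<Rightarrow> ('g \<Rightarrow> 'r) \<Rightarrow> 'g ncpoly \<Rightarrow> 'r" where
  "ncpoly_value R \<phi> x \<beta> P =
     (\<Oplus>\<^bsub>R\<^esub>m \<in> Poly_Mapping.keys P.
        [Poly_Mapping.lookup P m] \<cdot>\<^bsub>R\<^esub>
          foldr (\<lambda>t a. var_value \<phi> x \<beta> t \<otimes>\<^bsub>R\<^esub> a) m \<one>\<^bsub>R\<^esub>)"

definition splits_cocycle ::
    "('r, 'k) ring_scheme \<Rightarrow> ('g \<Rightarrow> 'r \<Rightarrow> 'r) \<Rightarrow> 'g set \<Rightarrow> ('g \<Rightarrow> 'r) \<Rightarrow> 'r \<Rightarrow> bool" where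
  "splits_cocycle R \<phi> V \<beta> w \<longleftrightarrow>
     w \<in> carrier R \<and> (\<forall>g \<in> V. \<beta> g = \<phi> g w \<ominus>\<^bsub>R\<^esub> w)"

end

theory Submission
  imports Defs
begin

text \<open>For \<open>w = cyclic_solution y s\<close>, telescoping gives
  \<open>(\<sigma> - 1) w = \<Sum>\<^sub>k (\<sigma>\<^sup>k - 1)(y \<sigma>\<^sup>-\<^sup>k s) = (\<Sum>\<^sub>k \<sigma>\<^sup>k y) s - y (\<Sum>\<^sub>k \<sigma>\<^sup>-\<^sup>k s)\<close> with \<open>0 < k < p\<close>. If \<open>\<sigma>\<^sup>p\<close>
  fixes \<open>s\<close>, and \<open>1 + \<sigma> + \<dots> + \<sigma>\<^sup>p\<^sup>-\<^sup>1\<close> sends \<open>y\<close> to \<open>1\<close> and \<open>s\<close> to \<open>0\<close>, this is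
  \<open>(1 - y) s + y s = s\<close>. The cocycle \<open>g \<mapsto> \<beta> g - (g - 1) w\<^sub>1\<close> vanishes on \<open>U'\<close>, so its value \<open>s'\<close>
  at \<open>\<sigma>\<close> is \<open>U'\<close>-invariant and killed by \<open>1 + \<sigma> + \<dots> + \<sigma>\<^sup>p\<^sup>-\<^sup>1\<close>, and the cyclic formula applies to it. The
  polynomial form follows because functions given by noncommutative polynomials are closed under
  the ring operations and the action of \<open>U\<close>.\<close>

subsection \<open>Subgroups of prime index\<close>

text \<open>One polynomial has to serve every ring, action, x and \<beta> over the given types.
  Expressibility is therefore a property of functions of all these data
  (\<open>nc_expressible\<close>), and the closure lemmas combine such functions, never elements of
  one fixed ring. The obstacle is the recursive call: its polynomial is in the u'(x') and
  u'(\<beta>(v')), and x' is not a variable for U. It can be substituted because x' is a sum of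
  variables \<sigma>^i(x) and the action only translates variables.

  The cyclic formula matches the remaining cocycle only at \<sigma>. Agreement on all of U follows
  because the cosets U' \<sigma>^i cover U and w_2 is U'-invariant, so that the coboundary of w_2
  vanishes on U' as well. The exponent p is the order of \<sigma> modulo U'. The order of \<sigma>
  itself can be larger, and \<sigma>^{-k} may be replaced by \<sigma>^{p-k} only on U'-invariant
  elements.\<close>

lemma (in group) index_prime_normal:
  assumes p: "Factorial_Ring.prime p" and ord: "order G = p ^ n"
    and H: "subgroup H G" and idx: "card (rcosets H) = p"
  shows "H \<lhd> G"
proof -
  interpret H: subgroup H G by (rule H)
  let ?H = "G\<lparr>carrier := H\<rparr>"
  \<comment> \<open>\<open>H\<close> acts on its \<open>p\<close> right cosets and fixes the coset \<open>H\<close>. The other orbits have fewer than \<open>p\<close>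
    elements and \<open>p\<close>-power size, so every coset is fixed, which says that \<open>H\<close> is normal.\<close>
  let ?\<psi> = "\<lambda>h. \<lambda>C \<in> rcosets H. C #> inv h"
  have gH: "group ?H" by (rule subgroup_imp_group[OF H])
  have p0: "p > 0" using p by (simp add: prime_gt_0_nat)
  have coset_closed: "C #> g \<in> rcosets H" if "C \<in> rcosets H" "g \<in> carrier G" for C g
    using that H.subset by (force simp: RCOSETS_def coset_mult_assoc)
  have comp: "C #> g #> h = C #> (g \<otimes> h)" if "C \<in> rcosets H" "g \<in> carrier G" "h \<in> carrier G" for C g h
    using that rcosets_part_G[OF H] by (intro coset_mult_assoc) auto
  have triv: "C #> \<one> = C" if "C \<in> rcosets H" for C
    using that rcosets_part_G[OF H] by (intro coset_mult_one) auto
  have bij: "?\<psi> h \<in> Bij (rcosets H)" if "h \<in> H" for h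
  proof -
    have "bij_betw (\<lambda>C. C #> inv h) (rcosets H) (rcosets H)"
      using that H.mem_carrier
      by (intro bij_betwI[where g = "\<lambda>C. C #> h"]) (auto simp: coset_closed comp triv)
    then show ?thesis by (simp add: Bij_def bij_betw_def inj_on_def)
  qed
  \<comment> \<open>Right multiplication reverses products and so does inversion; together they give
    a left action.\<close>
  have "?\<psi> \<in> hom ?H (BijGroup (rcosets H))"
  proof (rule homI)
    fix g h assume "g \<in> carrier ?H" "h \<in> carrier ?H"
    then have g: "g \<in> H" "g \<in> carrier G" and h: "h \<in> H" "h \<in> carrier G"
      using H.mem_carrier by auto
    show "?\<psi> (g \<otimes>\<^bsub>?H\<^esub> h) = ?\<psi> g \<otimes>\<^bsub>BijGroup (rcosets H)\<^esub> ?\<psi> h"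
      using g h by (auto simp: BijGroup_def bij compose_def coset_closed comp inv_mult_group fun_eq_iff)
  qed (auto simp: BijGroup_def bij)
  then interpret act: group_action ?H "rcosets H" ?\<psi>
    by (simp add: group_action_def group_hom_def group_hom_axioms_def gH group_BijGroup)
  have H_in: "H \<in> rcosets H" by (rule H.subgroup_in_rcosets[OF is_group])
  have fixed: "C #> inv h = C" if C: "C \<in> rcosets H" and h: "h \<in> H" for C h
  proof (cases "C = H")
    case True
    then show ?thesis using h by (simp add: H.rcos_const)
  next
    case False
    let ?O = "orbit ?H ?\<psi> C"
    \<comment> \<open>If C k^{-1} = H with k in \<open>H\<close>, then C = H k = H, which is
      excluded here.\<close>
    have O_sub: "?O \<subseteq> rcosets H - {H}"
    proof -
      have "C #> inv k \<noteq> H" if "k \<in> H" for k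
      proof
        assume "C #> inv k = H"
        then have "C #> inv k #> k = H #> k" by simp
        then show False using that False C H.mem_carrier H.rcos_const by (simp add: comp triv)
      qed
      then show ?thesis using C H.mem_carrier by (auto simp: orbit_def coset_closed)
    qed
    \<comment> \<open>An infinite set has \<open>card\<close> 0, so a positive \<open>card\<close>
      yields finiteness.\<close>
    have finR: "finite (rcosets H)" using idx p0 card.infinite by fastforce
    have "card ?O \<le> card (rcosets H - {H})" using O_sub finR by (intro card_mono) auto
    also have "\<dots> < p" using idx H_in finR p0 by (simp add: card_Diff_singleton)
    finally have lt: "card ?O < p" .
    have "card ?O dvd order ?H"
      using act.orbit_stabilizer_theorem[OF C] by (metis dvd_triv_left)
    also have "order ?H dvd order G"
      unfolding lagrange[OF H, symmetric] by (simp add: order_def)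
    finally obtain k where k: "card ?O = p ^ k"
      using divides_primepow_nat[OF p] ord by metis
    with lt have "card ?O = 1"
      using p0 by (cases k) auto
    moreover have "C \<in> ?O" using act.orbit_refl[OF C] .
    moreover have "C #> inv h \<in> ?O" using C h by (auto simp: orbit_def)
    ultimately show ?thesis by (metis card_1_singletonE singletonD)
  qed
  show ?thesis
  proof (subst normal_inv_iff, intro conjI ballI H)
    fix x h assume x: "x \<in> carrier G" and h: "h \<in> H"
    \<comment> \<open>The coset of \<open>x\<close> is fixed by the element \<open>inv h\<close>.
      The resulting equality H x h = H x says that x h x^{-1} lies in \<open>H\<close>.\<close>
    have "H #> x #> inv (inv h) = H #> x"
      using x h by (intro fixed) (auto simp: RCOSETS_def)
    then have "H #> x #> h #> inv x = H #> x #> inv x" using h H.mem_carrier by simp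
    then have "H #> (x \<otimes> h \<otimes> inv x) = H"
      using x h H.mem_carrier H.subset by (simp add: coset_mult_assoc m_assoc)
    then show "x \<otimes> h \<otimes> inv x \<in> H"
      using x h H.mem_carrier H.subset by (metis inv_closed m_closed rcos_self H)
  qed
qed

lemma (in group) ex_normal_index_prime:
  assumes p: "Factorial_Ring.prime p" and ord: "order G = p ^ Suc n"
  shows "\<exists>H. H \<lhd> G \<and> card H = p ^ n \<and> card (rcosets H) = p"
proof -
  have p0: "p > 0" using p by (simp add: prime_gt_0_nat)
  have fin: "finite (carrier G)" using ord p0 order_gt_0_iff_finite by auto
  \<comment> \<open>This form of Sylow's theorem covers every prime power dividing the order; the
    cofactor is taken to be \<open>p\<close> itself.\<close>
  obtain H where H: "subgroup H G" "card H = p ^ n"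
    using sylow_thm[OF p is_group, of n p] ord fin by auto
  have "card (rcosets H) * card H = order G" using lagrange[OF H(1)] .
  then have "card (rcosets H) = p" using H(2) ord p0 by simp
  with H index_prime_normal[OF p ord H(1)] show ?thesis by blast
qed

lemma (in group) generate_prime_order:
  assumes p: "Factorial_Ring.prime (order G)" and a: "a \<in> carrier G" "a \<noteq> \<one>"
  shows "generate G {a} = carrier G"
proof -
  have fin: "finite (carrier G)" using prime_gt_0_nat[OF p] order_gt_0_iff_finite by simp
  have "ord a dvd order G" using ord_dvd_group_order[OF a(1)] .
  moreover have "ord a \<noteq> 1" using a ord_eq_1 by blast
  ultimately have "ord a = order G" using p prime_nat_iff by blast
  then have "card (generate G {a}) = card (carrier G)"
    using generate_pow_card[OF a(1)] by (simp add: order_def)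
  then show ?thesis
    using card_subset_eq[OF fin] generate_incl a(1) by (metis empty_subsetI insert_subset)
qed

lemma (in group) ex_index_p_extension:
  assumes p: "Factorial_Ring.prime p" and H: "H \<lhd> G" and idx: "card (rcosets H) = p"
  shows "\<exists>\<sigma>. index_p_extension p G H \<sigma>"
proof -
  interpret H: normal H G by (rule H)
  interpret Q: group "G Mod H" by (rule H.factorgroup_is_group)
  have ordQ: "order (G Mod H) = p" using idx by (simp add: order_def FactGroup_def)
  have "\<not> carrier (G Mod H) \<subseteq> {\<one>\<^bsub>G Mod H\<^esub>}"
    using ordQ prime_gt_1_nat[OF p] card_mono[of "{\<one>\<^bsub>G Mod H\<^esub>}" "carrier (G Mod H)"]
    by (auto simp: order_def)
  then obtain C where C: "C \<in> carrier (G Mod H)" "C \<noteq> \<one>\<^bsub>G Mod H\<^esub>" by auto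
  then obtain \<sigma> where "\<sigma> \<in> carrier G" "C = H #> \<sigma>"
    by (auto simp: FactGroup_def RCOSETS_def)
  with C Q.generate_prime_order[of C] p ordQ idx H show ?thesis
    unfolding index_p_extension_def by auto
qed

text \<open>The exponent starts at 1 because the recursion bottoms out at groups of order
  \<open>p\<close>; the trivial group has no admissible record.\<close>

lemma ex_admissible:
  assumes p: "Factorial_Ring.prime p"
  shows "group U \<Longrightarrow> order U = p ^ Suc n \<Longrightarrow> \<exists>c. admissible p U c"
proof (induction n arbitrary: U)
  case 0
  interpret group U by (rule 0)
  have "\<not> carrier U \<subseteq> {\<one>\<^bsub>U\<^esub>}"
    using 0 prime_gt_1_nat[OF p] card_mono[of "{\<one>\<^bsub>U\<^esub>}" "carrier U"] by (auto simp: order_def)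
  then obtain a where "a \<in> carrier U" "a \<noteq> \<one>\<^bsub>U\<^esub>" by auto
  with 0 p generate_prime_order have "admissible p U (Cyclic a)" by auto
  then show ?case ..
next
  case (Suc n)
  interpret group U by (rule Suc)
  obtain H where H: "H \<lhd> U" "card H = p ^ Suc n" "card (rcosets\<^bsub>U\<^esub> H) = p"
    using ex_normal_index_prime[OF p Suc.prems(2)] by auto
  obtain \<sigma> where \<sigma>: "index_p_extension p U H \<sigma>"
    using ex_index_p_extension[OF p H(1,3)] by blast
  have "group (U\<lparr>carrier := H\<rparr>)" using H(1) by (simp add: normal_imp_subgroup subgroup_imp_group)
  moreover have "order (U\<lparr>carrier := H\<rparr>) = p ^ Suc n" using H(2) by (simp add: order_def)
  ultimately obtain c where "admissible p (U\<lparr>carrier := H\<rparr>) c"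
    using Suc.IH by blast
  with \<sigma> have "admissible p U (Extend H \<sigma> c)" by simp
  then show ?case ..
qed

lemma (in normal) FactGroup_pow:
  assumes "a \<in> carrier G"
  shows "(H #> a) [^]\<^bsub>G Mod H\<^esub> (i::nat) = H #> (a [^] i)"
proof (induction i)
  case 0
  show ?case using subset by (simp add: FactGroup_def coset_mult_one)
next
  case (Suc i)
  have "(H #> a) [^]\<^bsub>G Mod H\<^esub> Suc i = (H #> a) [^]\<^bsub>G Mod H\<^esub> i <#> (H #> a)"
    by (simp add: nat_pow_def FactGroup_def)
  then show ?case using assms by (simp add: Suc rcos_sum)
qed

text \<open>The coset of \<open>\<sigma>\<close> generates a quotient with \<open>p\<close>
  elements, so it has order exactly \<open>p\<close>: its first \<open>p\<close> powers list every
  coset once, and the next one is trivial.\<close>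

lemma (in group) index_p_extension_cosets:
  assumes ext: "index_p_extension p G V \<sigma>" and p: "p > 0"
  shows "\<sigma> [^] p \<in> V"
    and "carrier G = (\<Union>i<p. V #> \<sigma> [^] i)"
    and "\<And>i j. i < p \<Longrightarrow> j < p \<Longrightarrow> i \<noteq> j \<Longrightarrow> (V #> \<sigma> [^] i) \<inter> (V #> \<sigma> [^] j) = {}"
proof -
  have V: "V \<lhd> G" and idx: "card (rcosets V) = p" and \<sigma>: "\<sigma> \<in> carrier G"
    and gen: "generate (G Mod V) {V #> \<sigma>} = carrier (G Mod V)"
    using ext by (auto simp: index_p_extension_def)
  interpret V: normal V G by (rule V)
  interpret Q: group "G Mod V" by (rule V.factorgroup_is_group)
  have sub: "subgroup V G" by (rule V.subgroup_axioms)
  have fin: "finite (carrier (G Mod V))"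
    using idx p card.infinite by (fastforce simp: FactGroup_def)
  have C: "V #> \<sigma> \<in> carrier (G Mod V)" using \<sigma> by (auto simp: FactGroup_def RCOSETS_def)
  have ord: "Q.ord (V #> \<sigma>) = p"
    using Q.generate_pow_card[OF C] gen idx by (simp add: FactGroup_def)
  have "V #> \<sigma> [^] p = V"
    using Q.pow_ord_eq_1[OF C] V.FactGroup_pow[OF \<sigma>, of p] unfolding ord by (simp add: FactGroup_def)
  then show "\<sigma> [^] p \<in> V" using \<sigma> sub rcos_self by (metis nat_pow_closed)
  have rng: "{0..p - 1} = {..<p}" using p by auto
  have "rcosets V = carrier (G Mod V)" by (simp add: FactGroup_def)
  also have "\<dots> = {(V #> \<sigma>) [^]\<^bsub>G Mod V\<^esub> i |i. i \<in> (UNIV :: nat set)}"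
    using Q.generate_pow_nat[OF C] gen ord p by auto
  also have "\<dots> = {(V #> \<sigma>) [^]\<^bsub>G Mod V\<^esub> i |i. i \<in> {0..Q.ord (V #> \<sigma>) - 1}}"
    using Q.ord_elems[OF fin C] by auto
  also have "\<dots> = (\<lambda>i. V #> \<sigma> [^] i) ` {..<p}"
    unfolding ord rng by (auto simp: V.FactGroup_pow[OF \<sigma>])
  finally have cosets: "rcosets V = (\<lambda>i. V #> \<sigma> [^] i) ` {..<p}" .
  then show "carrier G = (\<Union>i<p. V #> \<sigma> [^] i)" using rcosets_part_G[OF sub] by auto
  have inj: "inj_on (\<lambda>i. V #> \<sigma> [^] i) {..<p}"
    using Q.ord_inj[OF C] unfolding ord rng by (simp add: V.FactGroup_pow[OF \<sigma>])
  show "(V #> \<sigma> [^] i) \<inter> (V #> \<sigma> [^] j) = {}" if "i < p" "j < p" "i \<noteq> j" for i j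
  proof -
    have "V #> \<sigma> [^] i \<noteq> V #> \<sigma> [^] j" using that inj by (auto dest: inj_onD)
    moreover have "V #> \<sigma> [^] i \<in> rcosets V" "V #> \<sigma> [^] j \<in> rcosets V"
      using that cosets by auto
    ultimately show ?thesis using rcos_disjoint[OF sub] by (meson pairwise_def disjnt_def)
  qed
qed

text \<open>Makes a cyclic group of order \<open>p\<close> an instance of the extension step. Every
  element is a natural power of the generator, and this passes to cosets of the trivial
  subgroup.\<close>

lemma (in group) index_p_extension_trivial:
  assumes "order G = p" "\<sigma> \<in> carrier G" "generate G {\<sigma>} = carrier G" "p > 0"
  shows "index_p_extension p G {\<one>} \<sigma>"
proof -
  interpret T: normal "{\<one>}" G by (rule one_is_normal)
  interpret Q: group "G Mod {\<one>}" by (rule T.factorgroup_is_group)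
  have fin: "finite (carrier G)" using assms order_gt_0_iff_finite by blast
  have "generate (G Mod {\<one>}) {{\<one>} #> \<sigma>} = carrier (G Mod {\<one>})"
  proof
    have C: "{\<one>} #> \<sigma> \<in> carrier (G Mod {\<one>})" using assms by (auto simp: FactGroup_def RCOSETS_def)
    then show "generate (G Mod {\<one>}) {{\<one>} #> \<sigma>} \<subseteq> carrier (G Mod {\<one>})"
      by (intro Q.generate_incl) auto
    have "{\<one>} #> a \<in> generate (G Mod {\<one>}) {{\<one>} #> \<sigma>}" if "a \<in> carrier G" for a
    proof -
      have "\<exists>i::nat. a = \<sigma> [^] i"
        using that assms generate_pow_on_finite_carrier[OF fin assms(2)] by auto
      then obtain i where i: "a = \<sigma> [^] (i::nat)" ..
      have "({\<one>} #> \<sigma>) [^]\<^bsub>G Mod {\<one>}\<^esub> i \<in> generate (G Mod {\<one>}) {{\<one>} #> \<sigma>}"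
        using Q.generate_pow[OF C] by (auto intro!: exI[of _ "int i"] simp: int_pow_int)
      then show ?thesis using T.FactGroup_pow[OF assms(2)] i by simp
    qed
    then show "carrier (G Mod {\<one>}) \<subseteq> generate (G Mod {\<one>}) {{\<one>} #> \<sigma>}"
      by (auto simp: FactGroup_def RCOSETS_def)
  qed
  moreover have "card (rcosets {\<one>}) = p" using card_rcosets_triv fin assms(1) by simp
  ultimately show ?thesis using one_is_normal assms(2) by (simp add: index_p_extension_def)
qed

subsection \<open>Ring actions and cocycles\<close>

text \<open>Induction on the index set. \<open>finsum\<close> over an infinite set is zero by
  convention, so that case, like the empty one, reduces to f(0) = 0.\<close>

lemma (in abelian_group) additive_finsum:
  assumes f: "f \<in> carrier G \<rightarrow> carrier G"
    and add: "\<And>a b. a \<in> carrier G \<Longrightarrow> b \<in> carrier G \<Longrightarrow> f (a \<oplus> b) = f a \<oplus> f b"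
    and g: "g \<in> A \<rightarrow> carrier G"
  shows "f (finsum G g A) = (\<Oplus>i\<in>A. f (g i))"
proof -
  have "f \<zero> \<oplus> f \<zero> = f \<zero>" using add[of \<zero> \<zero>] by simp
  then have f0: "f \<zero> = \<zero>" using f by (metis PiE zero_closed add.r_cancel_one')
  show ?thesis using g
  proof (induction A rule: infinite_finite_induct)
    case (insert x F)
    have gc: "g x \<in> carrier G" "g \<in> F \<rightarrow> carrier G" using insert.prems by auto
    have "f (g x) \<in> carrier G" "(\<lambda>i. f (g i)) \<in> F \<rightarrow> carrier G" using gc f by blast+
    then show ?case using insert gc by (simp add: add)
  qed (simp_all add: f0)
qed

locale ring_action = U: group U + R: ring R
  for U :: "('g, 'm) monoid_scheme" and R :: "('r, 'k) ring_scheme" +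
  fixes \<phi> :: "'g \<Rightarrow> 'r \<Rightarrow> 'r"
  assumes action: "ring_automorphism_action U R \<phi>"
begin

lemma group_action: "group_action U (carrier R) \<phi>"
  using action by (simp add: ring_automorphism_action_def)

lemma act_hom: "u \<in> carrier U \<Longrightarrow> \<phi> u \<in> ring_hom R R"
  using action by (simp add: ring_automorphism_action_def ring_iso_def)

lemma act_closed [simp, intro]: "u \<in> carrier U \<Longrightarrow> r \<in> carrier R \<Longrightarrow> \<phi> u r \<in> carrier R"
  using act_hom ring_hom_closed by metis

lemma act_add: "u \<in> carrier U \<Longrightarrow> a \<in> carrier R \<Longrightarrow> b \<in> carrier R \<Longrightarrow> \<phi> u (a \<oplus>\<^bsub>R\<^esub> b) = \<phi> u a \<oplus>\<^bsub>R\<^esub> \<phi> u b"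
  using act_hom ring_hom_add by metis

lemma act_mult: "u \<in> carrier U \<Longrightarrow> a \<in> carrier R \<Longrightarrow> b \<in> carrier R \<Longrightarrow> \<phi> u (a \<otimes>\<^bsub>R\<^esub> b) = \<phi> u a \<otimes>\<^bsub>R\<^esub> \<phi> u b"
  using act_hom ring_hom_mult by metis

lemma act_ring_one [simp]: "u \<in> carrier U \<Longrightarrow> \<phi> u \<one>\<^bsub>R\<^esub> = \<one>\<^bsub>R\<^esub>"
  using act_hom ring_hom_one by metis

lemma act_ring_zero [simp]: "u \<in> carrier U \<Longrightarrow> \<phi> u \<zero>\<^bsub>R\<^esub> = \<zero>\<^bsub>R\<^esub>"
  using act_hom ring_hom_zero R.ring_axioms by metis

lemma act_neg: "u \<in> carrier U \<Longrightarrow> a \<in> carrier R \<Longrightarrow> \<phi> u (\<ominus>\<^bsub>R\<^esub> a) = \<ominus>\<^bsub>R\<^esub> \<phi> u a"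
  by (metis R.add.inv_closed R.minus_equality act_add act_closed act_ring_zero R.l_neg)

lemma act_minus: "u \<in> carrier U \<Longrightarrow> a \<in> carrier R \<Longrightarrow> b \<in> carrier R \<Longrightarrow> \<phi> u (a \<ominus>\<^bsub>R\<^esub> b) = \<phi> u a \<ominus>\<^bsub>R\<^esub> \<phi> u b"
  by (simp add: a_minus_def act_add act_neg)

lemma act_comp: "u \<in> carrier U \<Longrightarrow> v \<in> carrier U \<Longrightarrow> r \<in> carrier R \<Longrightarrow> \<phi> (u \<otimes>\<^bsub>U\<^esub> v) r = \<phi> u (\<phi> v r)"
  using group_action.composition_rule[OF group_action] by metis

lemma act_one [simp]: "r \<in> carrier R \<Longrightarrow> \<phi> \<one>\<^bsub>U\<^esub> r = r"
  using group_action.id_eq_one[OF group_action] by (metis restrict_apply')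

lemma act_finsum:
  "u \<in> carrier U \<Longrightarrow> f \<in> A \<rightarrow> carrier R \<Longrightarrow> \<phi> u (finsum R f A) = (\<Oplus>\<^bsub>R\<^esub>i\<in>A. \<phi> u (f i))"
  by (intro R.additive_finsum) (auto simp: act_add)

lemma norm_closed [simp, intro]:
  "V \<subseteq> carrier U \<Longrightarrow> r \<in> carrier R \<Longrightarrow> action_norm R \<phi> V r \<in> carrier R"
  unfolding action_norm_def by (rule R.finsum_closed) auto

lemma geometric_closed [simp, intro]:
  "u \<in> carrier U \<Longrightarrow> r \<in> carrier R \<Longrightarrow> geometric_action U R \<phi> u k r \<in> carrier R"
  unfolding geometric_action_def by (rule R.finsum_closed) auto

text \<open>Left translation by \<open>v\<close> permutes the summation index
  \<open>V\<close>.\<close>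

lemma norm_invariant:
  assumes V: "subgroup V U" and v: "v \<in> V" and r: "r \<in> carrier R"
  shows "\<phi> v (action_norm R \<phi> V r) = action_norm R \<phi> V r"
proof -
  note mem = subgroup.mem_carrier[OF V]
  have img: "(\<lambda>g. v \<otimes>\<^bsub>U\<^esub> g) ` V = V"
    using U.coset_join3[OF mem[OF v] V v] by (auto simp: l_coset_def)
  have inj: "inj_on (\<lambda>g. v \<otimes>\<^bsub>U\<^esub> g) V" using v mem by (auto simp: inj_on_def)
  have "\<phi> v (action_norm R \<phi> V r) = (\<Oplus>\<^bsub>R\<^esub>g\<in>V. \<phi> v (\<phi> g r))"
    unfolding action_norm_def using v r mem by (intro act_finsum) auto
  also have "\<dots> = (\<Oplus>\<^bsub>R\<^esub>g\<in>V. \<phi> (v \<otimes>\<^bsub>U\<^esub> g) r)"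
    using v r mem by (intro R.finsum_cong') (auto simp: act_comp)
  also have "\<dots> = finsum R (\<lambda>g. \<phi> g r) ((\<lambda>g. v \<otimes>\<^bsub>U\<^esub> g) ` V)"
    using v r mem inj by (intro R.finsum_reindex[symmetric]) auto
  finally show ?thesis by (simp add: img action_norm_def)
qed

text \<open>Since u g = (u g u^{-1}) u, moving \<open>u\<close> past the sum conjugates the index,
  and conjugation permutes a normal subgroup.\<close>

lemma norm_act_commute:
  assumes V: "V \<lhd> U" and u: "u \<in> carrier U" and r: "r \<in> carrier R"
  shows "\<phi> u (action_norm R \<phi> V r) = action_norm R \<phi> V (\<phi> u r)"
proof -
  interpret V: normal V U by (rule V)
  let ?c = "\<lambda>g. u \<otimes>\<^bsub>U\<^esub> g \<otimes>\<^bsub>U\<^esub> inv\<^bsub>U\<^esub> u"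
  have canc: "inv\<^bsub>U\<^esub> u \<otimes>\<^bsub>U\<^esub> (u \<otimes>\<^bsub>U\<^esub> g) = g" "u \<otimes>\<^bsub>U\<^esub> (inv\<^bsub>U\<^esub> u \<otimes>\<^bsub>U\<^esub> g) = g" if "g \<in> V" for g
    using that u V.mem_carrier by (simp_all add: U.m_assoc[symmetric])
  have bij: "bij_betw ?c V V"
    using u V.mem_carrier V.inv_op_closed1 V.inv_op_closed2
    by (intro bij_betwI[where g = "\<lambda>g. inv\<^bsub>U\<^esub> u \<otimes>\<^bsub>U\<^esub> g \<otimes>\<^bsub>U\<^esub> u"])
      (auto simp: U.m_assoc canc)
  have "\<phi> u (action_norm R \<phi> V r) = (\<Oplus>\<^bsub>R\<^esub>g\<in>V. \<phi> u (\<phi> g r))"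
    unfolding action_norm_def using u r V.mem_carrier by (intro act_finsum) auto
  also have "\<dots> = (\<Oplus>\<^bsub>R\<^esub>g\<in>V. \<phi> (?c g) (\<phi> u r))"
    using u r V.mem_carrier
    by (intro R.finsum_cong') (auto simp: act_comp[symmetric] U.m_assoc)
  also have "\<dots> = finsum R (\<lambda>g. \<phi> g (\<phi> u r)) (?c ` V)"
    using u r V.mem_carrier bij
    by (intro R.finsum_reindex[symmetric]) (auto simp: bij_betw_def)
  finally show ?thesis using bij by (simp add: action_norm_def bij_betw_def)
qed

lemma norm_add:
  assumes "V \<subseteq> carrier U" "a \<in> carrier R" "b \<in> carrier R"
  shows "action_norm R \<phi> V (a \<oplus>\<^bsub>R\<^esub> b) = action_norm R \<phi> V a \<oplus>\<^bsub>R\<^esub> action_norm R \<phi> V b"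
proof -
  have "action_norm R \<phi> V (a \<oplus>\<^bsub>R\<^esub> b) = (\<Oplus>\<^bsub>R\<^esub>g\<in>V. \<phi> g a \<oplus>\<^bsub>R\<^esub> \<phi> g b)"
    unfolding action_norm_def using assms by (intro R.finsum_cong') (auto simp: act_add)
  also have "\<dots> = action_norm R \<phi> V a \<oplus>\<^bsub>R\<^esub> action_norm R \<phi> V b"
    unfolding action_norm_def using assms by (intro R.finsum_addf) auto
  finally show ?thesis .
qed

lemma norm_finsum:
  assumes "V \<subseteq> carrier U" "f \<in> A \<rightarrow> carrier R"
  shows "action_norm R \<phi> V (finsum R f A) = (\<Oplus>\<^bsub>R\<^esub>i\<in>A. action_norm R \<phi> V (f i))"
  using assms by (intro R.additive_finsum) (auto simp: norm_add)

lemma invariantsI: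
  "V \<subseteq> carrier U \<Longrightarrow> r \<in> carrier R \<Longrightarrow> (\<And>v. v \<in> V \<Longrightarrow> \<phi> v r = r) \<Longrightarrow> r \<in> action_invariants R \<phi> V"
  by (simp add: action_invariants_def)

lemma invariants_mult:
  "V \<subseteq> carrier U \<Longrightarrow> a \<in> action_invariants R \<phi> V \<Longrightarrow> b \<in> action_invariants R \<phi> V \<Longrightarrow>
    a \<otimes>\<^bsub>R\<^esub> b \<in> action_invariants R \<phi> V"
  by (auto simp: action_invariants_def act_mult subset_iff)

lemma invariants_finsum:
  assumes V: "V \<subseteq> carrier U" and f: "\<And>i. i \<in> A \<Longrightarrow> f i \<in> action_invariants R \<phi> V"
  shows "finsum R f A \<in> action_invariants R \<phi> V"
proof -
  have fc: "f \<in> A \<rightarrow> carrier R" using f by (auto simp: action_invariants_def)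
  have "\<phi> v (finsum R f A) = finsum R f A" if "v \<in> V" for v
  proof -
    have "\<phi> v (finsum R f A) = (\<Oplus>\<^bsub>R\<^esub>i\<in>A. \<phi> v (f i))" using that V fc by (intro act_finsum) auto
    also have "\<dots> = finsum R f A"
      using f that by (intro R.finsum_cong' refl) (auto simp: action_invariants_def)
    finally show ?thesis .
  qed
  then show ?thesis using fc by (simp add: action_invariants_def)
qed

text \<open>Rewriting v u = u (u^{-1} v u) moves \<open>v\<close> to an element of \<open>V\<close>
  acting directly on \<open>r\<close>. This is what keeps \<open>w\<^sub>2\<close>
  invariant.\<close>

lemma invariants_act:
  assumes V: "V \<lhd> U" and u: "u \<in> carrier U" and r: "r \<in> action_invariants R \<phi> V"
  shows "\<phi> u r \<in> action_invariants R \<phi> V"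
proof -
  interpret V: normal V U by (rule V)
  have rc: "r \<in> carrier R" using r by (simp add: action_invariants_def)
  have "\<phi> v (\<phi> u r) = \<phi> u r" if v: "v \<in> V" for v
  proof -
    have w: "inv\<^bsub>U\<^esub> u \<otimes>\<^bsub>U\<^esub> v \<otimes>\<^bsub>U\<^esub> u \<in> V" using V.inv_op_closed1[OF u v] .
    have "v \<otimes>\<^bsub>U\<^esub> u = u \<otimes>\<^bsub>U\<^esub> (inv\<^bsub>U\<^esub> u \<otimes>\<^bsub>U\<^esub> v \<otimes>\<^bsub>U\<^esub> u)"
      using u v V.mem_carrier by (simp add: U.m_assoc[symmetric])
    then have "\<phi> v (\<phi> u r) = \<phi> u (\<phi> (inv\<^bsub>U\<^esub> u \<otimes>\<^bsub>U\<^esub> v \<otimes>\<^bsub>U\<^esub> u) r)"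
      using u v w rc V.mem_carrier by (metis act_comp)
    also have "\<dots> = \<phi> u r" using w r by (simp add: action_invariants_def)
    finally show ?thesis .
  qed
  then show ?thesis using u rc by (simp add: action_invariants_def)
qed

lemma geometric_Suc:
  assumes "u \<in> carrier U" "r \<in> carrier R"
  shows "geometric_action U R \<phi> u (Suc k) r = \<phi> (u [^]\<^bsub>U\<^esub> k) r \<oplus>\<^bsub>R\<^esub> geometric_action U R \<phi> u k r"
  using assms unfolding geometric_action_def lessThan_Suc by (subst R.finsum_insert) auto

lemma geometric_telescope:
  assumes u: "u \<in> carrier U" and r: "r \<in> carrier R"
  shows "\<phi> u (geometric_action U R \<phi> u k r) \<ominus>\<^bsub>R\<^esub> geometric_action U R \<phi> u k r = \<phi> (u [^]\<^bsub>U\<^esub> k) r \<ominus>\<^bsub>R\<^esub> r"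
proof (induction k)
  case 0
  show ?case using u r by (simp add: geometric_action_def a_minus_def R.r_neg)
next
  case (Suc k)
  let ?g = "geometric_action U R \<phi> u k r" and ?p = "\<phi> (u [^]\<^bsub>U\<^esub> k) r"
  have c: "?g \<in> carrier R" "?p \<in> carrier R" "\<phi> u ?g \<in> carrier R" "\<phi> u ?p \<in> carrier R" using u r by auto
  \<comment> \<open>The new factor \<open>u\<close> is split off on the left, so that it acts last,
    on the term \<open>?p\<close> already present.\<close>
  have "\<phi> (u [^]\<^bsub>U\<^esub> Suc k) r = \<phi> u ?p"
    using u r by (simp only: U.nat_pow_Suc2) (simp add: act_comp)
  moreover have "\<phi> u ?p \<oplus>\<^bsub>R\<^esub> \<phi> u ?g \<ominus>\<^bsub>R\<^esub> (?p \<oplus>\<^bsub>R\<^esub> ?g)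
      = \<phi> u ?p \<ominus>\<^bsub>R\<^esub> ?p \<oplus>\<^bsub>R\<^esub> (\<phi> u ?g \<ominus>\<^bsub>R\<^esub> ?g)"
    using c by (simp add: a_minus_def R.minus_add R.a_ac)
  moreover have "\<phi> u ?p \<ominus>\<^bsub>R\<^esub> ?p \<oplus>\<^bsub>R\<^esub> (?p \<ominus>\<^bsub>R\<^esub> r) = \<phi> u ?p \<ominus>\<^bsub>R\<^esub> r"
    using c r by (simp add: a_minus_def R.a_assoc R.r_neg1)
  ultimately show ?case
    using u r c by (simp only: geometric_Suc act_add Suc)
qed

text \<open>Iterating the cocycle rule along powers of \<open>u\<close> builds up the geometric sum.
  With k = 0 it gives \<beta>(1) = 0; with k = p it shows that the geometric sum kills
  \<open>s'\<close>.\<close>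

lemma cocycle_geometric:
  assumes \<beta>: "one_cocycle U R \<phi> \<beta>" and u: "u \<in> carrier U"
  shows "geometric_action U R \<phi> u k (\<beta> u) = \<beta> (u [^]\<^bsub>U\<^esub> k)"
proof (induction k)
  case 0
  have "\<beta> \<one>\<^bsub>U\<^esub> \<in> carrier R" "\<beta> \<one>\<^bsub>U\<^esub> = \<beta> \<one>\<^bsub>U\<^esub> \<oplus>\<^bsub>R\<^esub> \<phi> \<one>\<^bsub>U\<^esub> (\<beta> \<one>\<^bsub>U\<^esub>)"
    using \<beta> unfolding one_cocycle_def by (force simp: Pi_def, metis U.one_closed U.r_one)
  then have "\<beta> \<one>\<^bsub>U\<^esub> = \<zero>\<^bsub>R\<^esub>" by (metis R.add.r_cancel_one' act_one)
  then show ?case by (simp add: geometric_action_def)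
next
  case (Suc k)
  have c: "\<beta> u \<in> carrier R" "\<beta> (u [^]\<^bsub>U\<^esub> k) \<in> carrier R"
    using \<beta> u unfolding one_cocycle_def by (auto simp: Pi_def)
  have "\<beta> (u [^]\<^bsub>U\<^esub> k \<otimes>\<^bsub>U\<^esub> u) = \<beta> (u [^]\<^bsub>U\<^esub> k) \<oplus>\<^bsub>R\<^esub> \<phi> (u [^]\<^bsub>U\<^esub> k) (\<beta> u)"
    using \<beta> u unfolding one_cocycle_def by (metis U.nat_pow_closed)
  then show ?case using u c by (simp add: geometric_Suc Suc R.a_comm)
qed

text \<open>The map g -> (g - 1) w is itself a cocycle, and the cocycle rule is additive.\<close>

lemma cocycle_minus_coboundary:
  assumes \<beta>: "one_cocycle U R \<phi> \<beta>" and w: "w \<in> carrier R"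
  shows "one_cocycle U R \<phi> (\<lambda>g. \<beta> g \<ominus>\<^bsub>R\<^esub> (\<phi> g w \<ominus>\<^bsub>R\<^esub> w))"
proof -
  have bc: "\<And>g. g \<in> carrier U \<Longrightarrow> \<beta> g \<in> carrier R"
    and b: "\<And>g h. g \<in> carrier U \<Longrightarrow> h \<in> carrier U \<Longrightarrow> \<beta> (g \<otimes>\<^bsub>U\<^esub> h) = \<beta> g \<oplus>\<^bsub>R\<^esub> \<phi> g (\<beta> h)"
    using \<beta> by (auto simp: one_cocycle_def)
  have "\<beta> (g \<otimes>\<^bsub>U\<^esub> h) \<ominus>\<^bsub>R\<^esub> (\<phi> (g \<otimes>\<^bsub>U\<^esub> h) w \<ominus>\<^bsub>R\<^esub> w)
      = \<beta> g \<ominus>\<^bsub>R\<^esub> (\<phi> g w \<ominus>\<^bsub>R\<^esub> w) \<oplus>\<^bsub>R\<^esub> \<phi> g (\<beta> h \<ominus>\<^bsub>R\<^esub> (\<phi> h w \<ominus>\<^bsub>R\<^esub> w))"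
    if g: "g \<in> carrier U" and h: "h \<in> carrier U" for g h
  proof -
    \<comment> \<open>The element \<open>e\<close> will be \<open>\<phi> g w\<close>: the term for
      \<open>g\<close> subtracts it, and the translated term for \<open>h\<close> adds it
      back.\<close>
    have alg: "a \<oplus>\<^bsub>R\<^esub> b \<ominus>\<^bsub>R\<^esub> (c \<ominus>\<^bsub>R\<^esub> d) = a \<ominus>\<^bsub>R\<^esub> (e \<ominus>\<^bsub>R\<^esub> d) \<oplus>\<^bsub>R\<^esub> (b \<ominus>\<^bsub>R\<^esub> (c \<ominus>\<^bsub>R\<^esub> e))"
      if "a \<in> carrier R" "b \<in> carrier R" "c \<in> carrier R" "d \<in> carrier R" "e \<in> carrier R" for a b c d e
    proof -
      have "e \<oplus>\<^bsub>R\<^esub> (\<ominus>\<^bsub>R\<^esub> c \<oplus>\<^bsub>R\<^esub> \<ominus>\<^bsub>R\<^esub> e) = \<ominus>\<^bsub>R\<^esub> c"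
        using that by (subst R.a_lcomm) (auto simp: R.r_neg)
      then show ?thesis using that by (simp add: a_minus_def R.minus_add R.a_ac R.r_neg1 R.r_neg2)
    qed
    show ?thesis using g h w bc
        alg[of "\<beta> g" "\<phi> g (\<beta> h)" "\<phi> g (\<phi> h w)" w "\<phi> g w"]
      by (simp add: b act_comp act_minus)
  qed
  then show ?thesis using bc w by (auto simp: one_cocycle_def)
qed

end

lemma (in abelian_group) finsum_diff:
  assumes "f \<in> A \<rightarrow> carrier G" "g \<in> A \<rightarrow> carrier G"
  shows "(\<Oplus>i\<in>A. f i \<ominus> g i) = finsum G f A \<ominus> finsum G g A"
proof -
  have "\<ominus> finsum G g A = (\<Oplus>i\<in>A. \<ominus> g i)"
    using assms by (intro additive_finsum) (auto simp: minus_add)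
  moreover have "(\<Oplus>i\<in>A. f i \<oplus> \<ominus> g i) = finsum G f A \<oplus> (\<Oplus>i\<in>A. \<ominus> g i)"
    using assms by (intro finsum_addf) auto
  ultimately show ?thesis by (simp add: a_minus_def)
qed

section \<open>The extension step along a normal subgroup of index \<open>p\<close>\<close>

locale index_p_ring_action = ring_action U R \<phi>
  for U :: "('g, 'm) monoid_scheme" and R :: "('r, 'k) ring_scheme" and \<phi> +
  fixes p :: nat and V :: "'g set" and \<sigma> :: 'g
  assumes ext: "index_p_extension p U V \<sigma>" and p_pos: "p > 0" and fin: "finite (carrier U)"
begin

lemma V_normal: "V \<lhd> U" and sigma [simp]: "\<sigma> \<in> carrier U"
  using ext by (auto simp: index_p_extension_def)

sublocale V: normal V U by (rule V_normal)

text \<open>\<open>cyclic_solution\<close> uses only the exponents 1 to p - 1, so exponent 0 has to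
  be separated from the full geometric sum.\<close>

lemma geometric_split:
  assumes r: "r \<in> carrier R"
  shows "geometric_action U R \<phi> \<sigma> p r = r \<oplus>\<^bsub>R\<^esub> (\<Oplus>\<^bsub>R\<^esub>k\<in>{1..p - 1}. \<phi> (\<sigma> [^]\<^bsub>U\<^esub> k) r)"
proof -
  have "{..<p} = insert 0 {1..p - 1}" using p_pos by auto
  then have "geometric_action U R \<phi> \<sigma> p r
      = \<phi> (\<sigma> [^]\<^bsub>U\<^esub> (0::nat)) r \<oplus>\<^bsub>R\<^esub> (\<Oplus>\<^bsub>R\<^esub>k\<in>{1..p - 1}. \<phi> (\<sigma> [^]\<^bsub>U\<^esub> k) r)"
    unfolding geometric_action_def using r by (simp only:) (subst R.finsum_insert, auto)
  then show ?thesis using r by simp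
qed

text \<open>The cosets V \<sigma>^i with i < p partition the group, and g \<sigma>^i acts as
  \<sigma>^i followed by \<open>g\<close>.\<close>

lemma norm_decomposition:
  assumes r: "r \<in> carrier R"
  shows "action_norm R \<phi> (carrier U) r = (\<Oplus>\<^bsub>R\<^esub>i\<in>{..<p}. action_norm R \<phi> V (\<phi> (\<sigma> [^]\<^bsub>U\<^esub> i) r))"
proof -
  note cosets = U.index_p_extension_cosets[OF ext p_pos]
  have fc: "finite (V #>\<^bsub>U\<^esub> \<sigma> [^]\<^bsub>U\<^esub> i)" for i :: nat
    using U.r_coset_subset_G[OF V.subset] fin by (metis U.nat_pow_closed rev_finite_subset sigma)
  have sub: "x \<in> carrier U" if "x \<in> V #>\<^bsub>U\<^esub> \<sigma> [^]\<^bsub>U\<^esub> i" for x and i :: nat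
    using that U.r_coset_subset_G[OF V.subset] by (meson U.nat_pow_closed sigma subsetD)
  have "action_norm R \<phi> (carrier U) r = (\<Oplus>\<^bsub>R\<^esub>i\<in>{..<p}. action_norm R \<phi> (V #>\<^bsub>U\<^esub> \<sigma> [^]\<^bsub>U\<^esub> i) r)"
    unfolding action_norm_def
    by (subst cosets(2), rule R.add.finprod_UN_disjoint)
      (use r fc cosets(3) sub in \<open>auto simp: pairwise_def disjnt_def\<close>)
  also have "\<dots> = (\<Oplus>\<^bsub>R\<^esub>i\<in>{..<p}. action_norm R \<phi> V (\<phi> (\<sigma> [^]\<^bsub>U\<^esub> i) r))"
  proof (intro R.finsum_cong' refl)
    fix i :: nat
    let ?s = "\<sigma> [^]\<^bsub>U\<^esub> i"
    have img: "V #>\<^bsub>U\<^esub> ?s = (\<lambda>g. g \<otimes>\<^bsub>U\<^esub> ?s) ` V" by (auto simp: r_coset_def)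
    have "action_norm R \<phi> (V #>\<^bsub>U\<^esub> ?s) r = (\<Oplus>\<^bsub>R\<^esub>g\<in>V. \<phi> (g \<otimes>\<^bsub>U\<^esub> ?s) r)"
      unfolding action_norm_def img using r V.mem_carrier
      by (intro R.finsum_reindex) (auto simp: inj_on_def)
    also have "\<dots> = action_norm R \<phi> V (\<phi> ?s r)"
      unfolding action_norm_def using r V.mem_carrier
      by (intro R.finsum_cong') (auto simp: act_comp)
    finally show "action_norm R \<phi> (V #>\<^bsub>U\<^esub> ?s) r = action_norm R \<phi> V (\<phi> ?s r)" .
  qed (use r V.subset in auto)
  finally show ?thesis .
qed

text \<open>The norm passes through the sum over powers of \<open>\<sigma>\<close>. This supplies
  the norm hypothesis on x' for the recursive call.\<close>

lemma norm_geometric: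
  assumes r: "r \<in> carrier R"
  shows "action_norm R \<phi> V (geometric_action U R \<phi> \<sigma> p r) = action_norm R \<phi> (carrier U) r"
  using r norm_decomposition[OF r] V.subset
  by (simp add: geometric_action_def norm_finsum Pi_def)

text \<open>By normality the norm over \<open>V\<close> commutes with the powers of
  \<open>\<sigma>\<close>, so the same coset decomposition also handles x''.\<close>

lemma geometric_norm:
  assumes r: "r \<in> carrier R"
  shows "geometric_action U R \<phi> \<sigma> p (action_norm R \<phi> V r) = action_norm R \<phi> (carrier U) r"
  using r norm_decomposition[OF r] V.subset
  by (simp add: geometric_action_def norm_act_commute[OF V_normal])

lemma cyclic_solution_invariant:
  assumes y: "y \<in> action_invariants R \<phi> V" and s: "s \<in> action_invariants R \<phi> V"
  shows "cyclic_solution p U R \<phi> \<sigma> y s \<in> action_invariants R \<phi> V"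
  unfolding cyclic_solution_def geometric_action_def using y s V.subset
  by (intro invariants_finsum invariants_act[OF V_normal] invariants_mult) auto

text \<open>Factors are never exchanged: \<open>s\<close> stays to the right of the translates of
  \<open>y\<close>, and \<open>y\<close> to the left of the translates of \<open>s\<close>, so
  \<open>Y\<close> and \<open>S\<close> are collected by one-sided distributivity.\<close>

lemma cyclic_solution_coboundary:
  assumes y: "y \<in> action_invariants R \<phi> V" and y1: "geometric_action U R \<phi> \<sigma> p y = \<one>\<^bsub>R\<^esub>"
    and s: "s \<in> action_invariants R \<phi> V" and s0: "geometric_action U R \<phi> \<sigma> p s = \<zero>\<^bsub>R\<^esub>"
  defines "w \<equiv> cyclic_solution p U R \<phi> \<sigma> y s"
  shows "s = \<phi> \<sigma> w \<ominus>\<^bsub>R\<^esub> w"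
proof -
  let ?K = "{1..p - 1}"
  have yc: "y \<in> carrier R" and sc: "s \<in> carrier R"
    using y s by (auto simp: action_invariants_def)
  define t where "t k = y \<otimes>\<^bsub>R\<^esub> \<phi> (inv\<^bsub>U\<^esub> (\<sigma> [^]\<^bsub>U\<^esub> k)) s" for k :: nat
  define Y where "Y = (\<Oplus>\<^bsub>R\<^esub>k\<in>?K. \<phi> (\<sigma> [^]\<^bsub>U\<^esub> k) y)"
  define S where "S = (\<Oplus>\<^bsub>R\<^esub>k\<in>?K. \<phi> (\<sigma> [^]\<^bsub>U\<^esub> k) s)"
  have tc: "t k \<in> carrier R" for k using yc sc by (simp add: t_def)
  have YS: "Y \<in> carrier R" "S \<in> carrier R" using yc sc by (auto simp: Y_def S_def)
  have eqY: "y \<oplus>\<^bsub>R\<^esub> Y = \<one>\<^bsub>R\<^esub>" using y1 geometric_split[OF yc] by (simp add: Y_def)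
  have eqS: "s \<oplus>\<^bsub>R\<^esub> S = \<zero>\<^bsub>R\<^esub>" using s0 geometric_split[OF sc] by (simp add: S_def)
  \<comment> \<open>The power \<sigma>^p need not be 1, but it lies in \<open>V\<close> and hence
    fixes \<open>s\<close>.\<close>
  have inv_pow: "\<phi> (inv\<^bsub>U\<^esub> (\<sigma> [^]\<^bsub>U\<^esub> k)) s = \<phi> (\<sigma> [^]\<^bsub>U\<^esub> (p - k)) s" if "k \<in> ?K" for k
  proof -
    have "\<sigma> [^]\<^bsub>U\<^esub> p = \<sigma> [^]\<^bsub>U\<^esub> k \<otimes>\<^bsub>U\<^esub> \<sigma> [^]\<^bsub>U\<^esub> (p - k)" using that by (auto simp: U.nat_pow_mult)
    then have "inv\<^bsub>U\<^esub> (\<sigma> [^]\<^bsub>U\<^esub> k) \<otimes>\<^bsub>U\<^esub> \<sigma> [^]\<^bsub>U\<^esub> p = \<sigma> [^]\<^bsub>U\<^esub> (p - k)"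
      by (simp add: U.m_assoc[symmetric])
    moreover have "\<phi> (\<sigma> [^]\<^bsub>U\<^esub> p) s = s"
      using U.index_p_extension_cosets(1)[OF ext p_pos] s by (simp add: action_invariants_def)
    ultimately show ?thesis using sc by (metis U.inv_closed U.nat_pow_closed act_comp sigma)
  qed
  have S': "(\<Oplus>\<^bsub>R\<^esub>k\<in>?K. \<phi> (inv\<^bsub>U\<^esub> (\<sigma> [^]\<^bsub>U\<^esub> k)) s) = S"
  proof -
    \<comment> \<open>The reflection k -> p - k turns the sum over inverse powers into the sum over
      positive powers.\<close>
    have img: "(\<lambda>k. p - k) ` ?K = ?K"
    proof
      show "?K \<subseteq> (\<lambda>k. p - k) ` ?K"
      proof
        fix k assume "k \<in> ?K"
        then show "k \<in> (\<lambda>k. p - k) ` ?K" by (intro image_eqI[of _ _ "p - k"]) auto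
      qed
    qed auto
    have "(\<Oplus>\<^bsub>R\<^esub>k\<in>?K. \<phi> (inv\<^bsub>U\<^esub> (\<sigma> [^]\<^bsub>U\<^esub> k)) s) = (\<Oplus>\<^bsub>R\<^esub>k\<in>?K. \<phi> (\<sigma> [^]\<^bsub>U\<^esub> (p - k)) s)"
      using sc inv_pow by (intro R.finsum_cong') auto
    also have "\<dots> = (\<Oplus>\<^bsub>R\<^esub>k\<in>(\<lambda>k. p - k) ` ?K. \<phi> (\<sigma> [^]\<^bsub>U\<^esub> k) s)"
      using sc by (intro R.finsum_reindex[symmetric]) (auto simp: inj_on_def)
    finally show ?thesis by (simp only: img S_def)
  qed
  have w: "w = (\<Oplus>\<^bsub>R\<^esub>k\<in>?K. geometric_action U R \<phi> \<sigma> k (t k))"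
    by (simp add: w_def cyclic_solution_def t_def)
  have "\<phi> \<sigma> w \<ominus>\<^bsub>R\<^esub> w
      = (\<Oplus>\<^bsub>R\<^esub>k\<in>?K. \<phi> \<sigma> (geometric_action U R \<phi> \<sigma> k (t k)) \<ominus>\<^bsub>R\<^esub> geometric_action U R \<phi> \<sigma> k (t k))"
    unfolding w using tc by (subst R.finsum_diff) (auto simp: act_finsum)
  also have "\<dots> = (\<Oplus>\<^bsub>R\<^esub>k\<in>?K. \<phi> (\<sigma> [^]\<^bsub>U\<^esub> k) (t k) \<ominus>\<^bsub>R\<^esub> t k)"
    using tc by (simp add: geometric_telescope)
  also have "\<dots> = (\<Oplus>\<^bsub>R\<^esub>k\<in>?K. \<phi> (\<sigma> [^]\<^bsub>U\<^esub> k) y \<otimes>\<^bsub>R\<^esub> s \<ominus>\<^bsub>R\<^esub> t k)"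
  proof (intro R.finsum_cong' refl)
    fix k :: nat
    have "\<phi> (\<sigma> [^]\<^bsub>U\<^esub> k) (\<phi> (inv\<^bsub>U\<^esub> (\<sigma> [^]\<^bsub>U\<^esub> k)) s) = s"
      using sc by (simp add: act_comp[symmetric])
    then show "\<phi> (\<sigma> [^]\<^bsub>U\<^esub> k) (t k) \<ominus>\<^bsub>R\<^esub> t k = \<phi> (\<sigma> [^]\<^bsub>U\<^esub> k) y \<otimes>\<^bsub>R\<^esub> s \<ominus>\<^bsub>R\<^esub> t k"
      using yc sc by (simp add: t_def act_mult)
  qed (use yc sc tc in auto)
  also have "\<dots> = (\<Oplus>\<^bsub>R\<^esub>k\<in>?K. \<phi> (\<sigma> [^]\<^bsub>U\<^esub> k) y \<otimes>\<^bsub>R\<^esub> s) \<ominus>\<^bsub>R\<^esub> (\<Oplus>\<^bsub>R\<^esub>k\<in>?K. t k)"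
    using yc sc tc by (intro R.finsum_diff) auto
  also have "(\<Oplus>\<^bsub>R\<^esub>k\<in>?K. \<phi> (\<sigma> [^]\<^bsub>U\<^esub> k) y \<otimes>\<^bsub>R\<^esub> s) = Y \<otimes>\<^bsub>R\<^esub> s"
    unfolding Y_def using yc sc by (intro R.finsum_ldistr[symmetric]) auto
  also have "(\<Oplus>\<^bsub>R\<^esub>k\<in>?K. t k) = y \<otimes>\<^bsub>R\<^esub> S"
    unfolding t_def S'[symmetric] using yc sc by (intro R.finsum_rdistr[symmetric]) auto
  \<comment> \<open>The full geometric sum of \<open>s\<close> is zero, so omitting exponent 0
    leaves -s; this sign turns - y S into + y s.\<close>
  also have "S = \<ominus>\<^bsub>R\<^esub> s" using eqS YS sc by (metis R.a_comm R.minus_equality)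
  also have "Y \<otimes>\<^bsub>R\<^esub> s \<ominus>\<^bsub>R\<^esub> y \<otimes>\<^bsub>R\<^esub> (\<ominus>\<^bsub>R\<^esub> s) = (y \<oplus>\<^bsub>R\<^esub> Y) \<otimes>\<^bsub>R\<^esub> s"
    using YS yc sc by (simp add: a_minus_def R.r_minus R.l_distr R.a_comm)
  also have "\<dots> = s" using sc by (simp add: eqY)
  finally show ?thesis ..
qed

lemma extension_step:
  assumes \<beta>: "one_cocycle U R \<phi> \<beta>" and x: "x \<in> carrier R"
    and x1: "action_norm R \<phi> (carrier U) x = \<one>\<^bsub>R\<^esub>"
    and w1: "splits_cocycle R \<phi> V \<beta> w\<^sub>1"
  defines "s' \<equiv> \<beta> \<sigma> \<ominus>\<^bsub>R\<^esub> (\<phi> \<sigma> w\<^sub>1 \<ominus>\<^bsub>R\<^esub> w\<^sub>1)" and "x'' \<equiv> action_norm R \<phi> V x"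
  defines "w\<^sub>2 \<equiv> cyclic_solution p U R \<phi> \<sigma> x'' s'"
  shows "s' \<in> action_invariants R \<phi> V"
    and "geometric_action U R \<phi> \<sigma> p s' = \<zero>\<^bsub>R\<^esub>"
    and "x'' \<in> action_invariants R \<phi> V"
    and "geometric_action U R \<phi> \<sigma> p x'' = \<one>\<^bsub>R\<^esub>"
    and "w\<^sub>2 \<in> action_invariants R \<phi> V"
    and "s' = \<phi> \<sigma> w\<^sub>2 \<ominus>\<^bsub>R\<^esub> w\<^sub>2"
    and "splits_cocycle R \<phi> (carrier U) \<beta> (w\<^sub>1 \<oplus>\<^bsub>R\<^esub> w\<^sub>2)"
proof -
  have w1c: "w\<^sub>1 \<in> carrier R" and w1s: "\<And>g. g \<in> V \<Longrightarrow> \<beta> g = \<phi> g w\<^sub>1 \<ominus>\<^bsub>R\<^esub> w\<^sub>1"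
    using w1 by (auto simp: splits_cocycle_def)
  \<comment> \<open>Subtracting the coboundary of \<open>w\<^sub>1\<close> leaves a cocycle that vanishes on \<open>V\<close>; \<open>s'\<close> is its value at \<open>\<sigma>\<close>.\<close>
  define \<gamma> where "\<gamma> g = \<beta> g \<ominus>\<^bsub>R\<^esub> (\<phi> g w\<^sub>1 \<ominus>\<^bsub>R\<^esub> w\<^sub>1)" for g
  have \<gamma>: "one_cocycle U R \<phi> \<gamma>"
    using cocycle_minus_coboundary[OF \<beta> w1c] unfolding \<gamma>_def .
  have \<gamma>c: "\<And>g. g \<in> carrier U \<Longrightarrow> \<gamma> g \<in> carrier R"
    and \<gamma>m: "\<And>g h. g \<in> carrier U \<Longrightarrow> h \<in> carrier U \<Longrightarrow> \<gamma> (g \<otimes>\<^bsub>U\<^esub> h) = \<gamma> g \<oplus>\<^bsub>R\<^esub> \<phi> g (\<gamma> h)"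
    using \<gamma> by (auto simp: one_cocycle_def)
  have \<gamma>V: "\<gamma> g = \<zero>\<^bsub>R\<^esub>" if "g \<in> V" for g
    using that w1s w1c V.mem_carrier by (simp add: \<gamma>_def a_minus_def R.r_neg)
  have s': "s' = \<gamma> \<sigma>" by (simp add: s'_def \<gamma>_def)
  have s'c: "s' \<in> carrier R" by (simp add: s' \<gamma>c)
  show inv_s: "s' \<in> action_invariants R \<phi> V"
  proof (rule invariantsI[OF V.subset s'c])
    fix v assume v: "v \<in> V"
    have u: "inv\<^bsub>U\<^esub> \<sigma> \<otimes>\<^bsub>U\<^esub> v \<otimes>\<^bsub>U\<^esub> \<sigma> \<in> V" using V.inv_op_closed1[OF sigma v] .
    \<comment> \<open>Evaluating \<open>\<gamma>\<close> on both factorizations, each with one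
      factor in \<open>V\<close> where \<open>\<gamma>\<close> vanishes, gives
      \<open>\<gamma> \<sigma>\<close> on one side and its translate by \<open>v\<close> on the
      other.\<close>
    have "v \<otimes>\<^bsub>U\<^esub> \<sigma> = \<sigma> \<otimes>\<^bsub>U\<^esub> (inv\<^bsub>U\<^esub> \<sigma> \<otimes>\<^bsub>U\<^esub> v \<otimes>\<^bsub>U\<^esub> \<sigma>)"
      using v V.mem_carrier by (simp add: U.m_assoc[symmetric])
    then have "\<gamma> (v \<otimes>\<^bsub>U\<^esub> \<sigma>) = \<gamma> \<sigma> \<oplus>\<^bsub>R\<^esub> \<phi> \<sigma> (\<gamma> (inv\<^bsub>U\<^esub> \<sigma> \<otimes>\<^bsub>U\<^esub> v \<otimes>\<^bsub>U\<^esub> \<sigma>))"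
      using u V.mem_carrier by (metis \<gamma>m sigma)
    then have "\<gamma> (v \<otimes>\<^bsub>U\<^esub> \<sigma>) = \<gamma> \<sigma>" using u \<gamma>c by (simp add: \<gamma>V)
    moreover have "\<gamma> (v \<otimes>\<^bsub>U\<^esub> \<sigma>) = \<phi> v (\<gamma> \<sigma>)"
      using v V.mem_carrier \<gamma>c by (simp add: \<gamma>m \<gamma>V)
    ultimately show "\<phi> v s' = s'" by (simp add: s')
  qed
  \<comment> \<open>The sum equals \<open>\<gamma>\<close> at \<sigma>^p, which lies in
    \<open>V\<close>.\<close>
  show geo_s: "geometric_action U R \<phi> \<sigma> p s' = \<zero>\<^bsub>R\<^esub>"
    using cocycle_geometric[OF \<gamma> sigma] U.index_p_extension_cosets(1)[OF ext p_pos]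
    by (simp add: s' \<gamma>V)
  show inv_x: "x'' \<in> action_invariants R \<phi> V"
    unfolding x''_def using x V.subset norm_invariant[OF V.subgroup_axioms]
    by (intro invariantsI) auto
  show geo_x: "geometric_action U R \<phi> \<sigma> p x'' = \<one>\<^bsub>R\<^esub>"
    unfolding x''_def using geometric_norm[OF x] x1 by simp
  show inv_w: "w\<^sub>2 \<in> action_invariants R \<phi> V"
    unfolding w\<^sub>2_def by (rule cyclic_solution_invariant[OF inv_x inv_s])
  show s_w: "s' = \<phi> \<sigma> w\<^sub>2 \<ominus>\<^bsub>R\<^esub> w\<^sub>2"
    unfolding w\<^sub>2_def by (rule cyclic_solution_coboundary[OF inv_x geo_x inv_s geo_s])
  have w2c: "w\<^sub>2 \<in> carrier R" using inv_w by (simp add: action_invariants_def)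
  \<comment> \<open>The cocycle rule carries the agreement at \<open>\<sigma>\<close> to its powers;
    the intermediate terms \<sigma>^i w_2 cancel.\<close>
  have pow: "\<gamma> (\<sigma> [^]\<^bsub>U\<^esub> i) = \<phi> (\<sigma> [^]\<^bsub>U\<^esub> i) w\<^sub>2 \<ominus>\<^bsub>R\<^esub> w\<^sub>2" for i :: nat
  proof (induction i)
    case 0
    show ?case using w2c \<gamma>V V.one_closed by (simp add: a_minus_def R.r_neg)
  next
    case (Suc i)
    let ?s = "\<sigma> [^]\<^bsub>U\<^esub> i"
    have "\<gamma> (\<sigma> [^]\<^bsub>U\<^esub> Suc i) = (\<phi> ?s w\<^sub>2 \<ominus>\<^bsub>R\<^esub> w\<^sub>2) \<oplus>\<^bsub>R\<^esub> \<phi> ?s (\<phi> \<sigma> w\<^sub>2 \<ominus>\<^bsub>R\<^esub> w\<^sub>2)"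
      using s_w s' by (simp add: \<gamma>m Suc)
    also have "\<dots> = (\<phi> ?s w\<^sub>2 \<ominus>\<^bsub>R\<^esub> w\<^sub>2) \<oplus>\<^bsub>R\<^esub> (\<phi> (\<sigma> [^]\<^bsub>U\<^esub> Suc i) w\<^sub>2 \<ominus>\<^bsub>R\<^esub> \<phi> ?s w\<^sub>2)"
      using w2c by (simp add: act_minus act_comp)
    also have "\<dots> = \<phi> (\<sigma> [^]\<^bsub>U\<^esub> Suc i) w\<^sub>2 \<ominus>\<^bsub>R\<^esub> w\<^sub>2"
      using w2c U.nat_pow_closed[OF sigma, of "Suc i"]
      by (simp add: a_minus_def R.a_ac R.r_neg1 R.r_neg2 del: U.nat_pow_Suc)
    finally show ?case .
  qed
  \<comment> \<open>Write g = v \<sigma>^i. Since \<gamma>(v) = 0, the value at \<open>g\<close> is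
    the translate by \<open>v\<close> of the value at \<sigma>^i, and invariance of
    \<open>w\<^sub>2\<close> turns v w_2 back into w_2.\<close>
  have all: "\<gamma> g = \<phi> g w\<^sub>2 \<ominus>\<^bsub>R\<^esub> w\<^sub>2" if g: "g \<in> carrier U" for g
  proof -
    obtain i v where v: "v \<in> V" and gv: "g = v \<otimes>\<^bsub>U\<^esub> \<sigma> [^]\<^bsub>U\<^esub> (i::nat)"
      using g U.index_p_extension_cosets(2)[OF ext p_pos] by (auto simp: r_coset_def)
    have "\<gamma> g = \<phi> v (\<gamma> (\<sigma> [^]\<^bsub>U\<^esub> i))"
      using v V.mem_carrier \<gamma>c by (simp add: gv \<gamma>m \<gamma>V)
    also have "\<dots> = \<phi> g w\<^sub>2 \<ominus>\<^bsub>R\<^esub> \<phi> v w\<^sub>2"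
      using v V.mem_carrier w2c by (simp add: pow gv act_minus act_comp)
    finally show ?thesis using v inv_w by (simp add: action_invariants_def)
  qed
  have "\<beta> g = \<phi> g (w\<^sub>1 \<oplus>\<^bsub>R\<^esub> w\<^sub>2) \<ominus>\<^bsub>R\<^esub> (w\<^sub>1 \<oplus>\<^bsub>R\<^esub> w\<^sub>2)" if g: "g \<in> carrier U" for g
  proof -
    have c: "\<beta> g \<in> carrier R" "\<phi> g w\<^sub>1 \<in> carrier R" "\<phi> g w\<^sub>2 \<in> carrier R"
      using \<beta> g w1c w2c by (auto simp: one_cocycle_def)
    have "\<beta> g = d \<oplus>\<^bsub>R\<^esub> (\<beta> g \<ominus>\<^bsub>R\<^esub> d)" if "d \<in> carrier R" for d
      unfolding a_minus_def using c that by (subst R.a_lcomm) (auto simp: R.r_neg)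
    then have "\<beta> g = (\<phi> g w\<^sub>1 \<ominus>\<^bsub>R\<^esub> w\<^sub>1) \<oplus>\<^bsub>R\<^esub> \<gamma> g"
      unfolding \<gamma>_def using c w1c by blast
    also have "\<dots> = (\<phi> g w\<^sub>1 \<ominus>\<^bsub>R\<^esub> w\<^sub>1) \<oplus>\<^bsub>R\<^esub> (\<phi> g w\<^sub>2 \<ominus>\<^bsub>R\<^esub> w\<^sub>2)"
      by (simp only: all[OF g])
    also have "\<dots> = (\<phi> g w\<^sub>1 \<oplus>\<^bsub>R\<^esub> \<phi> g w\<^sub>2) \<ominus>\<^bsub>R\<^esub> (w\<^sub>1 \<oplus>\<^bsub>R\<^esub> w\<^sub>2)"
      using c w1c w2c by (simp add: a_minus_def R.a_ac R.minus_add)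
    also have "\<dots> = \<phi> g (w\<^sub>1 \<oplus>\<^bsub>R\<^esub> w\<^sub>2) \<ominus>\<^bsub>R\<^esub> (w\<^sub>1 \<oplus>\<^bsub>R\<^esub> w\<^sub>2)"
      using g w1c w2c by (simp add: act_add)
    finally show ?thesis .
  qed
  then show "splits_cocycle R \<phi> (carrier U) \<beta> (w\<^sub>1 \<oplus>\<^bsub>R\<^esub> w\<^sub>2)"
    using w1c w2c by (simp add: splits_cocycle_def)
qed

end

subsection \<open>Noncommutative polynomial expressions\<close>

definition nc_vars :: "'g set \<Rightarrow> 'g var set" where
  "nc_vars V = XVar ` V \<union> {BVar u v |u v. u \<in> V \<and> v \<in> V}"

lemma in_nc_vars [simp]:
  "XVar u \<in> nc_vars V \<longleftrightarrow> u \<in> V"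
  "BVar u v \<in> nc_vars V \<longleftrightarrow> u \<in> V \<and> v \<in> V"
  by (auto simp: nc_vars_def)

lemma ncpolys_over_iff:
  "P \<in> ncpolys_over V \<longleftrightarrow> (\<forall>m \<in> Poly_Mapping.keys P. set m \<subseteq> nc_vars V)"
  by (simp add: ncpolys_over_def nc_vars_def)

abbreviation word_value ::
    "('r, 'k) ring_scheme \<Rightarrow> ('g \<Rightarrow> 'r \<Rightarrow> 'r) \<Rightarrow> 'r \<Rightarrow> ('g \<Rightarrow> 'r) \<Rightarrow> 'g var list \<Rightarrow> 'r" where
  "word_value R \<phi> x \<beta> m \<equiv> foldr (\<lambda>t a. var_value \<phi> x \<beta> t \<otimes>\<^bsub>R\<^esub> a) m \<one>\<^bsub>R\<^esub>"

text \<open>As g(u(r)) = (g u)(r), the action on values lifts to left translation of variables. Only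
  the outer group element moves; the argument of \<beta> stays.\<close>

primrec translate_var :: "('g, 'm) monoid_scheme \<Rightarrow> 'g \<Rightarrow> 'g var \<Rightarrow> 'g var" where
  "translate_var U g (XVar u) = XVar (g \<otimes>\<^bsub>U\<^esub> u)"
| "translate_var U g (BVar u v) = BVar (g \<otimes>\<^bsub>U\<^esub> u) v"

lemma cocycle_data_ring_action: "group U \<Longrightarrow> cocycle_data U R \<phi> x \<beta> \<Longrightarrow> ring_action U R \<phi>"
  by (simp add: ring_action_def ring_action_axioms_def cocycle_data_def)

lemma cocycle_data_closed:
  "cocycle_data U R \<phi> x \<beta> \<Longrightarrow> x \<in> carrier R"
  "cocycle_data U R \<phi> x \<beta> \<Longrightarrow> v \<in> carrier U \<Longrightarrow> \<beta> v \<in> carrier R"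
  by (auto simp: cocycle_data_def one_cocycle_def)

context
  fixes U :: "('g, 'm) monoid_scheme" and R :: "('r, 'k) ring_scheme" and \<phi> x \<beta>
  assumes U: "group U" and data: "cocycle_data U R \<phi> x \<beta>"
begin

interpretation ring_action U R \<phi> by (rule cocycle_data_ring_action[OF U data])

lemma var_value_closed: "t \<in> nc_vars (carrier U) \<Longrightarrow> var_value \<phi> x \<beta> t \<in> carrier R"
  using cocycle_data_closed[OF data] by (cases t) auto

lemma word_value_closed: "set m \<subseteq> nc_vars (carrier U) \<Longrightarrow> word_value R \<phi> x \<beta> m \<in> carrier R"
  by (induction m) (auto intro!: R.m_closed var_value_closed)

lemma word_value_append:
  "set m \<subseteq> nc_vars (carrier U) \<Longrightarrow> set m' \<subseteq> nc_vars (carrier U) \<Longrightarrow>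
    word_value R \<phi> x \<beta> (m @ m') = word_value R \<phi> x \<beta> m \<otimes>\<^bsub>R\<^esub> word_value R \<phi> x \<beta> m'"
proof (induction m)
  case Nil
  then show ?case using word_value_closed[of m'] by simp
next
  case (Cons t m)
  have "var_value \<phi> x \<beta> t \<in> carrier R" "word_value R \<phi> x \<beta> m \<in> carrier R" "word_value R \<phi> x \<beta> m' \<in> carrier R"
    using Cons.prems by (auto intro!: var_value_closed word_value_closed)
  with Cons show ?case by (simp add: R.m_assoc)
qed

lemma var_value_act:
  "u \<in> carrier U \<Longrightarrow> t \<in> nc_vars (carrier U) \<Longrightarrow>
    \<phi> u (var_value \<phi> x \<beta> t) = var_value \<phi> x \<beta> (translate_var U u t)"
  using cocycle_data_closed[OF data] by (cases t) (auto simp: act_comp)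

lemma word_value_act:
  "u \<in> carrier U \<Longrightarrow> set m \<subseteq> nc_vars (carrier U) \<Longrightarrow>
    \<phi> u (word_value R \<phi> x \<beta> m) = word_value R \<phi> x \<beta> (map (translate_var U u) m)"
proof (induction m)
  case (Cons t m)
  have "var_value \<phi> x \<beta> t \<in> carrier R" "word_value R \<phi> x \<beta> m \<in> carrier R"
    using Cons.prems by (auto intro!: var_value_closed word_value_closed)
  with Cons show ?case by (simp add: act_mult var_value_act)
qed simp

text \<open>Words outside the support contribute zero. This lets P, Q and P + Q be summed over one
  common set, although cancellation may shrink the support of P + Q.\<close>

lemma ncpoly_value_superset:
  assumes "finite K" "Poly_Mapping.keys P \<subseteq> K" "\<And>m. m \<in> K \<Longrightarrow> set m \<subseteq> nc_vars (carrier U)"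
  shows "ncpoly_value R \<phi> x \<beta> P =
    (\<Oplus>\<^bsub>R\<^esub>m\<in>K. [Poly_Mapping.lookup P m] \<cdot>\<^bsub>R\<^esub> word_value R \<phi> x \<beta> m)"
proof -
  have "[Poly_Mapping.lookup P m] \<cdot>\<^bsub>R\<^esub> word_value R \<phi> x \<beta> m = \<zero>\<^bsub>R\<^esub>"
    if "m \<in> K - Poly_Mapping.keys P" for m
    using that by (simp add: in_keys_iff add_pow_def)
  then show ?thesis
    unfolding ncpoly_value_def using assms word_value_closed
    by (intro R.add.finprod_mono_neutral_cong_left) auto
qed

lemma ncpoly_value_closed:
  "P \<in> ncpolys_over (carrier U) \<Longrightarrow> ncpoly_value R \<phi> x \<beta> P \<in> carrier R"
  unfolding ncpoly_value_def ncpolys_over_iff using word_value_closed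
  by (intro R.finsum_closed) auto

lemma ncpoly_value_add:
  assumes P: "P \<in> ncpolys_over (carrier U)" and Q: "Q \<in> ncpolys_over (carrier U)"
  shows "ncpoly_value R \<phi> x \<beta> (P + Q) = ncpoly_value R \<phi> x \<beta> P \<oplus>\<^bsub>R\<^esub> ncpoly_value R \<phi> x \<beta> Q"
proof -
  let ?K = "Poly_Mapping.keys P \<union> Poly_Mapping.keys Q"
  have K: "set m \<subseteq> nc_vars (carrier U)" if "m \<in> ?K" for m
    using that P Q by (auto simp: ncpolys_over_iff)
  have sup: "ncpoly_value R \<phi> x \<beta> S = (\<Oplus>\<^bsub>R\<^esub>m\<in>?K. [Poly_Mapping.lookup S m] \<cdot>\<^bsub>R\<^esub> word_value R \<phi> x \<beta> m)"
    if "Poly_Mapping.keys S \<subseteq> ?K" for S :: "'g ncpoly"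
    using that K by (intro ncpoly_value_superset) auto
  have "ncpoly_value R \<phi> x \<beta> (P + Q)
      = (\<Oplus>\<^bsub>R\<^esub>m\<in>?K. [Poly_Mapping.lookup P m] \<cdot>\<^bsub>R\<^esub> word_value R \<phi> x \<beta> m
          \<oplus>\<^bsub>R\<^esub> [Poly_Mapping.lookup Q m] \<cdot>\<^bsub>R\<^esub> word_value R \<phi> x \<beta> m)"
    unfolding sup[OF keys_add] lookup_add
    using word_value_closed K by (intro R.finsum_cong' refl R.add.int_pow_mult) auto
  also have "\<dots> = ncpoly_value R \<phi> x \<beta> P \<oplus>\<^bsub>R\<^esub> ncpoly_value R \<phi> x \<beta> Q"
    using word_value_closed K by (subst (1 2) sup) (auto intro!: R.finsum_addf[symmetric])
  finally show ?thesis .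
qed

lemma ncpoly_value_single:
  assumes "set m \<subseteq> nc_vars (carrier U)"
  shows "ncpoly_value R \<phi> x \<beta> (Poly_Mapping.single m c) = [c] \<cdot>\<^bsub>R\<^esub> word_value R \<phi> x \<beta> m"
  \<comment> \<open>Summing over the set {m} also covers c = 0, where the support is empty.\<close>
  using assms word_value_closed[OF assms] by (subst ncpoly_value_superset[of "{m}"]) auto

end

lemma ncpolys_over_add:
  "P \<in> ncpolys_over V \<Longrightarrow> Q \<in> ncpolys_over V \<Longrightarrow> P + Q \<in> ncpolys_over V"
  using keys_add[of P Q] by (fastforce simp: ncpolys_over_iff)

section \<open>Functions of the data that are given by one polynomial\<close>

type_synonym ('g, 'r, 'k) data_function =
  "('r, 'k) ring_scheme \<Rightarrow> ('g \<Rightarrow> 'r \<Rightarrow> 'r) \<Rightarrow> 'r \<Rightarrow> ('g \<Rightarrow> 'r) \<Rightarrow> 'r"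

text \<open>The polynomial is chosen before the ring, the action, x and \<beta>; this order of
  quantifiers is the uniformity that the theorem claims.\<close>

definition nc_expressible ::
    "('g, 'm) monoid_scheme \<Rightarrow> ('g, 'r, 'k) data_function \<Rightarrow> bool" where
  "nc_expressible U F \<longleftrightarrow> (\<exists>P \<in> ncpolys_over (carrier U). \<forall>R \<phi> x \<beta>.
     cocycle_data U R \<phi> x \<beta> \<longrightarrow> F R \<phi> x \<beta> = ncpoly_value R \<phi> x \<beta> P)"

lemma nc_expressible_closed:
  "group U \<Longrightarrow> nc_expressible U F \<Longrightarrow> cocycle_data U R \<phi> x \<beta> \<Longrightarrow> F R \<phi> x \<beta> \<in> carrier R"
  unfolding nc_expressible_def using ncpoly_value_closed by metis

lemma nc_expressible_cong:
  assumes "nc_expressible U F"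
    and "\<And>R \<phi> x \<beta>. cocycle_data U R \<phi> x \<beta> \<Longrightarrow> G R \<phi> x \<beta> = F R \<phi> x \<beta>"
  shows "nc_expressible U G"
  using assms unfolding nc_expressible_def by metis

lemma nc_expressible_scaled_word:
  assumes "group U" "set m \<subseteq> nc_vars (carrier U)"
  shows "nc_expressible U (\<lambda>R \<phi> x \<beta>. [(c::int)] \<cdot>\<^bsub>R\<^esub> word_value R \<phi> x \<beta> m)"
proof -
  have "Poly_Mapping.single m c \<in> ncpolys_over (carrier U)"
    using assms(2) by (simp add: ncpolys_over_iff)
  then show ?thesis
    unfolding nc_expressible_def using ncpoly_value_single[OF assms(1) _ assms(2)] by metis
qed

lemma nc_expressible_add:
  assumes "group U" "nc_expressible U F" "nc_expressible U G"
  shows "nc_expressible U (\<lambda>R \<phi> x \<beta>. F R \<phi> x \<beta> \<oplus>\<^bsub>R\<^esub> G R \<phi> x \<beta>)"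
proof -
  obtain P Q where P: "P \<in> ncpolys_over (carrier U)" and Q: "Q \<in> ncpolys_over (carrier U)"
    and F: "\<And>R \<phi> x \<beta>. cocycle_data U R \<phi> x \<beta> \<Longrightarrow> F R \<phi> x \<beta> = ncpoly_value R \<phi> x \<beta> P"
    and G: "\<And>R \<phi> x \<beta>. cocycle_data U R \<phi> x \<beta> \<Longrightarrow> G R \<phi> x \<beta> = ncpoly_value R \<phi> x \<beta> Q"
    using assms(2,3) unfolding nc_expressible_def by metis
  show ?thesis
    unfolding nc_expressible_def using ncpolys_over_add[OF P Q]
    by (intro bexI[of _ "P + Q"]) (simp_all add: F G ncpoly_value_add[OF assms(1) _ P Q])
qed

lemma nc_expressible_zero: "nc_expressible U (\<lambda>R \<phi> x \<beta>. \<zero>\<^bsub>R\<^esub>)"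
proof -
  have "\<zero>\<^bsub>R\<^esub> = ncpoly_value R \<phi> x \<beta> 0" if "cocycle_data U R \<phi> x \<beta>"
    for R :: "('r, 'k) ring_scheme" and \<phi> x \<beta>
  proof -
    interpret ring R using that by (simp add: cocycle_data_def)
    show ?thesis by (simp add: ncpoly_value_def)
  qed
  then show ?thesis
    unfolding nc_expressible_def by (intro bexI[of _ 0]) (auto simp: ncpolys_over_iff)
qed

lemma nc_expressible_sum:
  fixes F :: "'a \<Rightarrow> ('g, 'r, 'k) data_function"
  assumes U: "group U" and F: "\<And>a. a \<in> A \<Longrightarrow> nc_expressible U (F a)"
  shows "nc_expressible U (\<lambda>R \<phi> x \<beta>. \<Oplus>\<^bsub>R\<^esub>a\<in>A. F a R \<phi> x \<beta>)"
  using F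
proof (induction A rule: infinite_finite_induct)
  case (infinite A)
  show ?case
  proof (rule nc_expressible_cong[OF nc_expressible_zero])
    fix R :: "('r, 'k) ring_scheme" and \<phi> x \<beta> assume "cocycle_data U R \<phi> x \<beta>"
    then interpret ring R by (simp add: cocycle_data_def)
    show "(\<Oplus>\<^bsub>R\<^esub>a\<in>A. F a R \<phi> x \<beta>) = \<zero>\<^bsub>R\<^esub>" using infinite by simp
  qed
next
  case empty
  show ?case
  proof (rule nc_expressible_cong[OF nc_expressible_zero])
    fix R :: "('r, 'k) ring_scheme" and \<phi> x \<beta> assume "cocycle_data U R \<phi> x \<beta>"
    then interpret ring R by (simp add: cocycle_data_def)
    show "(\<Oplus>\<^bsub>R\<^esub>a\<in>{}. F a R \<phi> x \<beta>) = \<zero>\<^bsub>R\<^esub>" by simp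
  qed
next
  case (insert b A)
  have "nc_expressible U (\<lambda>R \<phi> x \<beta>. F b R \<phi> x \<beta> \<oplus>\<^bsub>R\<^esub> (\<Oplus>\<^bsub>R\<^esub>a\<in>A. F a R \<phi> x \<beta>))"
    using insert by (intro nc_expressible_add U) auto
  then show ?case
  proof (rule nc_expressible_cong)
    fix R :: "('r, 'k) ring_scheme" and \<phi> x \<beta> assume d: "cocycle_data U R \<phi> x \<beta>"
    then interpret ring R by (simp add: cocycle_data_def)
    show "(\<Oplus>\<^bsub>R\<^esub>a\<in>insert b A. F a R \<phi> x \<beta>) = F b R \<phi> x \<beta> \<oplus>\<^bsub>R\<^esub> (\<Oplus>\<^bsub>R\<^esub>a\<in>A. F a R \<phi> x \<beta>)"
      using insert nc_expressible_closed[OF U _ d] by (intro finsum_insert) auto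
  qed
qed

text \<open>No product polynomial is written down. Expanding both sums, each product of two words is
  their concatenation, and closure under sums collects the resulting scaled words.\<close>

lemma nc_expressible_mult:
  fixes F G :: "('g, 'r, 'k) data_function"
  assumes U: "group U" and "nc_expressible U F" "nc_expressible U G"
  shows "nc_expressible U (\<lambda>R \<phi> x \<beta>. F R \<phi> x \<beta> \<otimes>\<^bsub>R\<^esub> G R \<phi> x \<beta>)"
proof -
  obtain P Q where P: "P \<in> ncpolys_over (carrier U)" and Q: "Q \<in> ncpolys_over (carrier U)"
    and F: "\<And>R \<phi> x \<beta>. cocycle_data U R \<phi> x \<beta> \<Longrightarrow> F R \<phi> x \<beta> = ncpoly_value R \<phi> x \<beta> P"
    and G: "\<And>R \<phi> x \<beta>. cocycle_data U R \<phi> x \<beta> \<Longrightarrow> G R \<phi> x \<beta> = ncpoly_value R \<phi> x \<beta> Q"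
    using assms(2,3) unfolding nc_expressible_def by metis
  let ?P = "Poly_Mapping.lookup P" and ?Q = "Poly_Mapping.lookup Q"
  have mP: "set m \<subseteq> nc_vars (carrier U)" if "m \<in> Poly_Mapping.keys P" for m
    using that P by (simp add: ncpolys_over_iff)
  have mQ: "set m \<subseteq> nc_vars (carrier U)" if "m \<in> Poly_Mapping.keys Q" for m
    using that Q by (simp add: ncpolys_over_iff)
  have "nc_expressible U (\<lambda>R \<phi> x \<beta>. \<Oplus>\<^bsub>R\<^esub>m\<in>Poly_Mapping.keys P. \<Oplus>\<^bsub>R\<^esub>m'\<in>Poly_Mapping.keys Q.
      [(?Q m' * ?P m)] \<cdot>\<^bsub>R\<^esub> word_value R \<phi> x \<beta> (m @ m'))"
    by (intro nc_expressible_sum nc_expressible_scaled_word U) (use mP mQ in simp)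
  then show ?thesis
  proof (rule nc_expressible_cong)
    fix R :: "('r, 'k) ring_scheme" and \<phi> x \<beta> assume d: "cocycle_data U R \<phi> x \<beta>"
    interpret ring_action U R \<phi> by (rule cocycle_data_ring_action[OF U d])
    let ?w = "word_value R \<phi> x \<beta>"
    have wP: "?w m \<in> carrier R" if "m \<in> Poly_Mapping.keys P" for m
      using word_value_closed[OF U d mP[OF that]] .
    have wQ: "?w m \<in> carrier R" if "m \<in> Poly_Mapping.keys Q" for m
      using word_value_closed[OF U d mQ[OF that]] .
    have "F R \<phi> x \<beta> \<otimes>\<^bsub>R\<^esub> G R \<phi> x \<beta> = (\<Oplus>\<^bsub>R\<^esub>m\<in>Poly_Mapping.keys P. \<Oplus>\<^bsub>R\<^esub>m'\<in>Poly_Mapping.keys Q.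
        ([?P m] \<cdot>\<^bsub>R\<^esub> ?w m) \<otimes>\<^bsub>R\<^esub> ([?Q m'] \<cdot>\<^bsub>R\<^esub> ?w m'))"
      unfolding F[OF d] G[OF d] ncpoly_value_def using wP wQ
      by (subst R.finsum_ldistr) (auto simp: R.finsum_rdistr intro!: R.finsum_cong' R.finsum_closed)
    also have "\<dots> = (\<Oplus>\<^bsub>R\<^esub>m\<in>Poly_Mapping.keys P. \<Oplus>\<^bsub>R\<^esub>m'\<in>Poly_Mapping.keys Q.
        [(?Q m' * ?P m)] \<cdot>\<^bsub>R\<^esub> ?w (m @ m'))"
    proof (intro R.finsum_cong' refl)
      fix m m' assume m: "m \<in> Poly_Mapping.keys P" and m': "m' \<in> Poly_Mapping.keys Q"
      show "([?P m] \<cdot>\<^bsub>R\<^esub> ?w m) \<otimes>\<^bsub>R\<^esub> ([?Q m'] \<cdot>\<^bsub>R\<^esub> ?w m') = [(?Q m' * ?P m)] \<cdot>\<^bsub>R\<^esub> ?w (m @ m')"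
        unfolding word_value_append[OF U d mP[OF m] mQ[OF m']]
        using wP[OF m] wQ[OF m']
        by (simp add: R.add_pow_ldistr_int R.add_pow_rdistr_int R.add.int_pow_pow mult.commute)
    qed (use wP wQ word_value_append[OF U d mP mQ] in \<open>auto intro!: R.finsum_closed\<close>)
    finally show "F R \<phi> x \<beta> \<otimes>\<^bsub>R\<^esub> G R \<phi> x \<beta> = (\<Oplus>\<^bsub>R\<^esub>m\<in>Poly_Mapping.keys P. \<Oplus>\<^bsub>R\<^esub>m'\<in>Poly_Mapping.keys Q.
        [(?Q m' * ?P m)] \<cdot>\<^bsub>R\<^esub> ?w (m @ m'))" .
  qed
qed

lemma nc_expressible_int:
  assumes "group U"
  shows "nc_expressible U (\<lambda>R \<phi> x \<beta>. [(c::int)] \<cdot>\<^bsub>R\<^esub> \<one>\<^bsub>R\<^esub>)"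
  using nc_expressible_scaled_word[OF assms, of "[]" c] by simp

lemma nc_expressible_one:
  assumes U: "group U"
  shows "nc_expressible U (\<lambda>(R :: ('r, 'k) ring_scheme) \<phi> x \<beta>. \<one>\<^bsub>R\<^esub>)"
proof (rule nc_expressible_cong[OF nc_expressible_int[OF U, of 1]])
  fix R :: "('r, 'k) ring_scheme" and \<phi> x \<beta> assume "cocycle_data U R \<phi> x \<beta>"
  then interpret ring R by (simp add: cocycle_data_def)
  show "\<one>\<^bsub>R\<^esub> = [(1 :: int)] \<cdot>\<^bsub>R\<^esub> \<one>\<^bsub>R\<^esub>" by simp
qed

text \<open>Scaling by \<open>c\<close> is multiplication by the constant c times 1, which is itself
  a scaled empty word.\<close>

lemma nc_expressible_scale:
  fixes F :: "('g, 'r, 'k) data_function"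
  assumes U: "group U" and F: "nc_expressible U F"
  shows "nc_expressible U (\<lambda>R \<phi> x \<beta>. [(c::int)] \<cdot>\<^bsub>R\<^esub> F R \<phi> x \<beta>)"
proof (rule nc_expressible_cong[OF nc_expressible_mult[OF U nc_expressible_int[OF U] F]])
  fix R :: "('r, 'k) ring_scheme" and \<phi> x \<beta> assume d: "cocycle_data U R \<phi> x \<beta>"
  then interpret ring R by (simp add: cocycle_data_def)
  show "[c] \<cdot>\<^bsub>R\<^esub> F R \<phi> x \<beta> = [c] \<cdot>\<^bsub>R\<^esub> \<one>\<^bsub>R\<^esub> \<otimes>\<^bsub>R\<^esub> F R \<phi> x \<beta>"
    using nc_expressible_closed[OF U F d] by (simp add: add_pow_ldistr_int)
qed

lemma nc_expressible_diff:
  fixes F G :: "('g, 'r, 'k) data_function"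
  assumes U: "group U" and F: "nc_expressible U F" and G: "nc_expressible U G"
  shows "nc_expressible U (\<lambda>R \<phi> x \<beta>. F R \<phi> x \<beta> \<ominus>\<^bsub>R\<^esub> G R \<phi> x \<beta>)"
proof (rule nc_expressible_cong[OF nc_expressible_add[OF U F nc_expressible_scale[OF U G, of "- 1"]]])
  fix R :: "('r, 'k) ring_scheme" and \<phi> x \<beta> assume d: "cocycle_data U R \<phi> x \<beta>"
  then interpret ring R by (simp add: cocycle_data_def)
  show "F R \<phi> x \<beta> \<ominus>\<^bsub>R\<^esub> G R \<phi> x \<beta> = F R \<phi> x \<beta> \<oplus>\<^bsub>R\<^esub> [(- 1 :: int)] \<cdot>\<^bsub>R\<^esub> G R \<phi> x \<beta>"
    using nc_expressible_closed[OF U G d] by (simp add: a_minus_def add.int_pow_neg)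
qed

text \<open>An automorphism fixes the integer coefficients and translates each variable of a word,
  so the image is again a sum of scaled words.\<close>

lemma nc_expressible_act:
  fixes F :: "('g, 'r, 'k) data_function"
  assumes U: "group U" and "nc_expressible U F" and u: "u \<in> carrier U"
  shows "nc_expressible U (\<lambda>R \<phi> x \<beta>. \<phi> u (F R \<phi> x \<beta>))"
proof -
  interpret U: group U by (rule U)
  obtain P where P: "P \<in> ncpolys_over (carrier U)"
    and F: "\<And>R \<phi> x \<beta>. cocycle_data U R \<phi> x \<beta> \<Longrightarrow> F R \<phi> x \<beta> = ncpoly_value R \<phi> x \<beta> P"
    using assms(2) unfolding nc_expressible_def by metis
  let ?P = "Poly_Mapping.lookup P"
  have mP: "set m \<subseteq> nc_vars (carrier U)" if "m \<in> Poly_Mapping.keys P" for m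
    using that P by (simp add: ncpolys_over_iff)
  have "translate_var U u t \<in> nc_vars (carrier U)" if "t \<in> nc_vars (carrier U)" for t
    using that u by (cases t) auto
  then have "nc_expressible U (\<lambda>R \<phi> x \<beta>. \<Oplus>\<^bsub>R\<^esub>m\<in>Poly_Mapping.keys P.
      [?P m] \<cdot>\<^bsub>R\<^esub> word_value R \<phi> x \<beta> (map (translate_var U u) m))"
    using mP by (intro nc_expressible_sum nc_expressible_scaled_word U) (fastforce simp: image_subset_iff)
  then show ?thesis
  proof (rule nc_expressible_cong)
    fix R :: "('r, 'k) ring_scheme" and \<phi> x \<beta> assume d: "cocycle_data U R \<phi> x \<beta>"
    interpret ring_action U R \<phi> by (rule cocycle_data_ring_action[OF U d])
    let ?w = "word_value R \<phi> x \<beta>"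
    have wP: "?w m \<in> carrier R" if "m \<in> Poly_Mapping.keys P" for m
      using word_value_closed[OF U d mP[OF that]] .
    have hom: "group_hom (add_monoid R) (add_monoid R) (\<phi> u)"
      using u by unfold_locales (auto simp: hom_def act_add)
    have "\<phi> u (F R \<phi> x \<beta>) = (\<Oplus>\<^bsub>R\<^esub>m\<in>Poly_Mapping.keys P. \<phi> u ([?P m] \<cdot>\<^bsub>R\<^esub> ?w m))"
      unfolding F[OF d] ncpoly_value_def using u wP by (intro act_finsum) auto
    also have "\<dots> = (\<Oplus>\<^bsub>R\<^esub>m\<in>Poly_Mapping.keys P. [?P m] \<cdot>\<^bsub>R\<^esub> ?w (map (translate_var U u) m))"
    proof (intro R.finsum_cong' refl)
      fix m assume m: "m \<in> Poly_Mapping.keys P"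
      show "\<phi> u ([?P m] \<cdot>\<^bsub>R\<^esub> ?w m) = [?P m] \<cdot>\<^bsub>R\<^esub> ?w (map (translate_var U u) m)"
        using group_hom.hom_int_pow[OF hom, of "?w m" "?P m"] wP[OF m]
          word_value_act[OF U d u mP[OF m]] by (simp add: add_pow_def)
    next
      show "(\<lambda>m. [?P m] \<cdot>\<^bsub>R\<^esub> ?w (map (translate_var U u) m)) \<in> Poly_Mapping.keys P \<rightarrow> carrier R"
        using u wP word_value_act[OF U d u mP, symmetric] by (auto simp del: foldr_map)
    qed
    finally show "\<phi> u (F R \<phi> x \<beta>)
      = (\<Oplus>\<^bsub>R\<^esub>m\<in>Poly_Mapping.keys P. [?P m] \<cdot>\<^bsub>R\<^esub> ?w (map (translate_var U u) m))" .
  qed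
qed

lemma nc_expressible_var:
  assumes U: "group U" and t: "t \<in> nc_vars (carrier U)"
  shows "nc_expressible U (\<lambda>(R :: ('r, 'k) ring_scheme) \<phi> x \<beta>. var_value \<phi> x \<beta> t)"
proof (rule nc_expressible_cong[OF nc_expressible_scaled_word[OF U, of "[t]" 1]])
  fix R :: "('r, 'k) ring_scheme" and \<phi> x \<beta> assume d: "cocycle_data U R \<phi> x \<beta>"
  then interpret ring R by (simp add: cocycle_data_def)
  show "var_value \<phi> x \<beta> t = [(1 :: int)] \<cdot>\<^bsub>R\<^esub> word_value R \<phi> x \<beta> [t]"
    using var_value_closed[OF U d t] by simp
qed (use t in simp)

text \<open>The variables stand for translates only; x itself is its translate by the identity of
  the group.\<close>

lemma nc_expressible_x:
  assumes "group U" shows "nc_expressible U (\<lambda>R \<phi> x \<beta>. x)"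
proof -
  interpret U: group U by (rule assms)
  show ?thesis
    by (rule nc_expressible_cong[OF nc_expressible_var[OF assms, of "XVar \<one>\<^bsub>U\<^esub>"]])
      (auto simp: ring_action.act_one[OF cocycle_data_ring_action[OF assms]] cocycle_data_closed)
qed

lemma nc_expressible_cocycle:
  assumes "group U" "v \<in> carrier U" shows "nc_expressible U (\<lambda>R \<phi> x \<beta>. \<beta> v)"
proof -
  interpret U: group U by (rule assms)
  show ?thesis using assms(2)
    by (intro nc_expressible_cong[OF nc_expressible_var[OF assms(1), of "BVar \<one>\<^bsub>U\<^esub> v"]])
      (auto simp: ring_action.act_one[OF cocycle_data_ring_action[OF assms(1)]] cocycle_data_closed)
qed

text \<open>Serves to turn the polynomial of the recursive call, written for a subgroup and x', into
  one for the whole group and x. Every variable is replaced by an expressible function; closure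
  under products and sums does the rest.\<close>

lemma nc_expressible_substitution:
  assumes U: "group U" and H: "H \<subseteq> carrier U" and P: "P \<in> ncpolys_over H" and Z: "nc_expressible U Z"
  shows "nc_expressible U (\<lambda>R \<phi> x \<beta>. ncpoly_value R \<phi> (Z R \<phi> x \<beta>) \<beta> P)"
proof -
  have var: "nc_expressible U (\<lambda>R \<phi> x \<beta>. var_value \<phi> (Z R \<phi> x \<beta>) \<beta> t)" if "t \<in> nc_vars H" for t
  proof (cases t)
    case (XVar u)
    then show ?thesis using that H nc_expressible_act[OF U Z, of u] by auto
  next
    case (BVar u v)
    then show ?thesis using that H nc_expressible_act[OF U nc_expressible_cocycle[OF U], of v u] by auto
  qed
  have "nc_expressible U (\<lambda>R \<phi> x \<beta>. word_value R \<phi> (Z R \<phi> x \<beta>) \<beta> m)" if "set m \<subseteq> nc_vars H" for m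
    using that
  proof (induction m)
    case Nil
    show ?case using nc_expressible_one[OF U] by simp
  next
    case (Cons t m)
    then have t: "t \<in> nc_vars H" and m: "set m \<subseteq> nc_vars H" by auto
    show ?case using nc_expressible_mult[OF U var[OF t] Cons.IH[OF m]] by simp
  qed
  then show ?thesis
    using P unfolding ncpoly_value_def ncpolys_over_iff
    by (intro nc_expressible_sum nc_expressible_scale U) auto
qed

lemma nc_expressible_geometric:
  assumes U: "group U" and F: "nc_expressible U F" and u: "u \<in> carrier U"
  shows "nc_expressible U (\<lambda>R \<phi> x \<beta>. geometric_action U R \<phi> u k (F R \<phi> x \<beta>))"
proof -
  interpret U: group U by (rule U)
  show ?thesis unfolding geometric_action_def using u
    by (intro nc_expressible_sum nc_expressible_act U F) auto
qed

lemma nc_expressible_norm: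
  assumes U: "group U" and F: "nc_expressible U F" and V: "V \<subseteq> carrier U"
  shows "nc_expressible U (\<lambda>R \<phi> x \<beta>. action_norm R \<phi> V (F R \<phi> x \<beta>))"
  unfolding action_norm_def using V
  by (intro nc_expressible_sum nc_expressible_act U F) auto

lemma nc_expressible_cyclic_solution:
  assumes U: "group U" and F: "nc_expressible U F" and G: "nc_expressible U G" and u: "u \<in> carrier U"
  shows "nc_expressible U (\<lambda>R \<phi> x \<beta>. cyclic_solution p U R \<phi> u (F R \<phi> x \<beta>) (G R \<phi> x \<beta>))"
proof -
  interpret U: group U by (rule U)
  show ?thesis unfolding cyclic_solution_def using u
    by (intro nc_expressible_sum nc_expressible_geometric nc_expressible_mult nc_expressible_act U F G) auto
qed

section \<open>Restriction to a subgroup and induction over the recorded choices\<close>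

lemma ring_automorphism_action_restrict:
  assumes U: "group U" and H: "subgroup H U" and act: "ring_automorphism_action U R \<phi>"
  shows "ring_automorphism_action (U\<lparr>carrier := H\<rparr>) R \<phi>"
proof -
  have "group_hom (U\<lparr>carrier := H\<rparr>) (BijGroup (carrier R)) \<phi>"
    using act group.subgroup_imp_group[OF U H] subgroup.mem_carrier[OF H]
    unfolding ring_automorphism_action_def group_action_def group_hom_def group_hom_axioms_def
    by (auto simp: hom_def)
  then show ?thesis
    using act subgroup.mem_carrier[OF H]
    by (simp add: ring_automorphism_action_def group_action_def)
qed

lemma cocycle_data_index_p_ring_action:
  "group U \<Longrightarrow> finite (carrier U) \<Longrightarrow> p > 0 \<Longrightarrow> index_p_extension p U V \<sigma> \<Longrightarrow>
    cocycle_data U R \<phi> x \<beta> \<Longrightarrow> index_p_ring_action U R \<phi> p V \<sigma>"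
  by (simp add: index_p_ring_action_def index_p_ring_action_axioms_def cocycle_data_ring_action)

text \<open>Replacing x by x' is what restores norm 1 over the smaller group; the action and \<beta>
  are simply restricted.\<close>

lemma cocycle_data_restrict:
  assumes U: "group U" and fin: "finite (carrier U)" and p: "p > 0"
    and ext: "index_p_extension p U V \<sigma>" and d: "cocycle_data U R \<phi> x \<beta>"
  shows "cocycle_data (U\<lparr>carrier := V\<rparr>) R \<phi> (geometric_action U R \<phi> \<sigma> p x) \<beta>"
proof -
  interpret index_p_ring_action U R \<phi> p V \<sigma>
    by (rule cocycle_data_index_p_ring_action[OF U fin p ext d])
  have x: "x \<in> carrier R" "action_norm R \<phi> (carrier U) x = \<one>\<^bsub>R\<^esub>" and \<beta>: "one_cocycle U R \<phi> \<beta>"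
    using d by (auto simp: cocycle_data_def)
  have "one_cocycle (U\<lparr>carrier := V\<rparr>) R \<phi> \<beta>"
    using \<beta> V.mem_carrier by (auto simp: one_cocycle_def)
  then show ?thesis
    using x R.ring_axioms ring_automorphism_action_restrict[OF U V.subgroup_axioms action]
    by (simp add: cocycle_data_def norm_geometric)
qed

text \<open>The recursive procedure is abstracted to \<open>F\<close>, so that the result serves
  both inside the induction on choices and for the separate claim about
  \<open>w\<^sub>1\<close>.\<close>

lemma recursive_call_correct:
  fixes U :: "('g, 'm) monoid_scheme" and R :: "('r, 'k) ring_scheme"
  assumes U: "group U" and fin: "finite (carrier U)" and p: "p > 0"
    and ext: "index_p_extension p U V \<sigma>"
    and expr: "nc_expressible (U\<lparr>carrier := V\<rparr>) F"
    and splits: "\<And>(R :: ('r, 'k) ring_scheme) \<phi> x \<beta>. cocycle_data (U\<lparr>carrier := V\<rparr>) R \<phi> x \<beta> \<Longrightarrow>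
      splits_cocycle R \<phi> V \<beta> (F R \<phi> x \<beta>)"
  shows "\<exists>P \<in> ncpolys_over V. \<forall>(R :: ('r, 'k) ring_scheme) \<phi> x \<beta>. cocycle_data U R \<phi> x \<beta> \<longrightarrow>
    (let x' = geometric_action U R \<phi> \<sigma> p x; w\<^sub>1 = F R \<phi> x' \<beta>
     in w\<^sub>1 = ncpoly_value R \<phi> x' \<beta> P \<and> splits_cocycle R \<phi> V \<beta> w\<^sub>1)"
proof -
  obtain P where P: "P \<in> ncpolys_over V"
    and F: "\<And>R \<phi> x \<beta>. cocycle_data (U\<lparr>carrier := V\<rparr>) R \<phi> x \<beta> \<Longrightarrow> F R \<phi> x \<beta> = ncpoly_value R \<phi> x \<beta> P"
    using expr unfolding nc_expressible_def by auto
  have "F R \<phi> x' \<beta> = ncpoly_value R \<phi> x' \<beta> P \<and> splits_cocycle R \<phi> V \<beta> (F R \<phi> x' \<beta>)"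
    if "cocycle_data U R \<phi> x \<beta>" "x' = geometric_action U R \<phi> \<sigma> p x"
    for R :: "('r, 'k) ring_scheme" and \<phi> x \<beta> x'
    using F splits cocycle_data_restrict[OF U fin p ext that(1)] unfolding that(2) by blast
  with P show ?thesis unfolding Let_def by blast
qed

text \<open>Structural induction on the record of choices. The group is left arbitrary because an
  \<open>Extend\<close> node continues in the subgroup.\<close>

lemma procedure_correct:
  fixes U :: "('g, 'm) monoid_scheme"
  assumes p: "p > 0"
  shows "group U \<Longrightarrow> finite (carrier U) \<Longrightarrow> admissible p U c \<Longrightarrow>
    nc_expressible U (\<lambda>(R :: ('r, 'k) ring_scheme) \<phi> x \<beta>. procedure p U R \<phi> c x \<beta>) \<and>
    (\<forall>(R :: ('r, 'k) ring_scheme) \<phi> x \<beta>. cocycle_data U R \<phi> x \<beta> \<longrightarrow>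
      splits_cocycle R \<phi> (carrier U) \<beta> (procedure p U R \<phi> c x \<beta>))"
proof (induction c arbitrary: U)
  case (Cyclic \<sigma>)
  \<comment> \<open>This is the inductive step for the trivial subgroup, with \<open>w\<^sub>1 = 0\<close>.\<close>
  interpret U: group U by (rule Cyclic)
  have ext: "index_p_extension p U {\<one>\<^bsub>U\<^esub>} \<sigma>" and \<sigma>: "\<sigma> \<in> carrier U"
    using Cyclic p U.index_p_extension_trivial by auto
  have "splits_cocycle R \<phi> (carrier U) \<beta> (cyclic_solution p U R \<phi> \<sigma> x (\<beta> \<sigma>))"
    if d: "cocycle_data U R \<phi> x \<beta>" for R :: "('r, 'k) ring_scheme" and \<phi> x \<beta>
  proof -
    interpret index_p_ring_action U R \<phi> p "{\<one>\<^bsub>U\<^esub>}" \<sigma>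
      by (rule cocycle_data_index_p_ring_action[OF Cyclic(1,2) p ext d])
    have x: "x \<in> carrier R" "action_norm R \<phi> (carrier U) x = \<one>\<^bsub>R\<^esub>" and \<beta>: "one_cocycle U R \<phi> \<beta>"
      using d by (auto simp: cocycle_data_def)
    have b: "\<beta> \<sigma> \<in> carrier R" using \<beta> \<sigma> by (auto simp: one_cocycle_def)
    have "\<beta> \<one>\<^bsub>U\<^esub> = \<zero>\<^bsub>R\<^esub>"
      using cocycle_geometric[OF \<beta> U.one_closed, of 0] by (simp add: geometric_action_def)
    then have "splits_cocycle R \<phi> {\<one>\<^bsub>U\<^esub>} \<beta> \<zero>\<^bsub>R\<^esub>"
      by (simp add: splits_cocycle_def a_minus_def)
    from extension_step(7)[OF \<beta> x this]
    have "splits_cocycle R \<phi> (carrier U) \<beta>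
        (\<zero>\<^bsub>R\<^esub> \<oplus>\<^bsub>R\<^esub> cyclic_solution p U R \<phi> \<sigma> x (\<beta> \<sigma>))"
      using x(1) b by (simp add: action_norm_def a_minus_def)
    \<comment> \<open>Membership in the carrier allows the summand \<open>w\<^sub>1\<close> = 0 to
      be dropped.\<close>
    moreover have "cyclic_solution p U R \<phi> \<sigma> x (\<beta> \<sigma>) \<in> carrier R"
      using x(1) b \<sigma> unfolding cyclic_solution_def by (intro R.finsum_closed) auto
    ultimately show ?thesis by simp
  qed
  then show ?case
    using nc_expressible_cyclic_solution[OF Cyclic(1) nc_expressible_x[OF Cyclic(1)]
        nc_expressible_cocycle[OF Cyclic(1) \<sigma>] \<sigma>] by simp
next
  case (Extend V \<sigma> c)
  interpret U: group U by (rule Extend)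
  have ext: "index_p_extension p U V \<sigma>" and adm: "admissible p (U\<lparr>carrier := V\<rparr>) c"
    using Extend.prems(3) by auto
  then have V: "subgroup V U" and \<sigma>: "\<sigma> \<in> carrier U"
    by (auto simp: index_p_extension_def normal_imp_subgroup)
  note Vsub = subgroup.subset[OF V]
  let ?F = "\<lambda>(R :: ('r, 'k) ring_scheme) \<phi> x \<beta>. procedure p (U\<lparr>carrier := V\<rparr>) R \<phi> c x \<beta>"
  have "group (U\<lparr>carrier := V\<rparr>)" "finite (carrier (U\<lparr>carrier := V\<rparr>))"
    using U.subgroup_imp_group[OF V] Vsub Extend.prems(2) by (auto intro: finite_subset)
  note IH = Extend.IH[OF this adm]
  obtain P where P: "P \<in> ncpolys_over V" and w1: "\<And>(R :: ('r, 'k) ring_scheme) \<phi> x \<beta>.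
      cocycle_data U R \<phi> x \<beta> \<Longrightarrow>
      ?F R \<phi> (geometric_action U R \<phi> \<sigma> p x) \<beta> = ncpoly_value R \<phi> (geometric_action U R \<phi> \<sigma> p x) \<beta> P \<and>
      splits_cocycle R \<phi> V \<beta> (?F R \<phi> (geometric_action U R \<phi> \<sigma> p x) \<beta>)"
    using recursive_call_correct[OF Extend.prems(1,2) p ext, of ?F] IH unfolding Let_def by auto
  let ?w1 = "\<lambda>(R :: ('r, 'k) ring_scheme) \<phi> x \<beta>. ?F R \<phi> (geometric_action U R \<phi> \<sigma> p x) \<beta>"
  have "nc_expressible U ?w1"
    using nc_expressible_substitution[OF Extend.prems(1) Vsub P
        nc_expressible_geometric[OF Extend.prems(1) nc_expressible_x[OF Extend.prems(1)] \<sigma>]]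
    by (rule nc_expressible_cong) (use w1 in blast)
  then have "nc_expressible U (\<lambda>(R :: ('r, 'k) ring_scheme) \<phi> x \<beta>. procedure p U R \<phi> (Extend V \<sigma> c) x \<beta>)"
    unfolding procedure.simps Let_def
    by (intro nc_expressible_add nc_expressible_cyclic_solution nc_expressible_norm nc_expressible_diff
        nc_expressible_act nc_expressible_x nc_expressible_cocycle Extend.prems(1) Vsub \<sigma>)
  moreover have "splits_cocycle R \<phi> (carrier U) \<beta> (procedure p U R \<phi> (Extend V \<sigma> c) x \<beta>)"
    if d: "cocycle_data U R \<phi> x \<beta>" for R :: "('r, 'k) ring_scheme" and \<phi> x \<beta>
  proof -
    interpret index_p_ring_action U R \<phi> p V \<sigma>
      by (rule cocycle_data_index_p_ring_action[OF Extend.prems(1,2) p ext d])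
    have x: "x \<in> carrier R" "action_norm R \<phi> (carrier U) x = \<one>\<^bsub>R\<^esub>" and \<beta>: "one_cocycle U R \<phi> \<beta>"
      using d by (auto simp: cocycle_data_def)
    show ?thesis
      using extension_step(7)[OF \<beta> x conjunct2[OF w1[OF d]]] by (simp add: Let_def)
  qed
  ultimately show ?case by blast
qed

theorem mainTheorem6:
  fixes U :: "('g, 'm) monoid_scheme" and p n :: nat
  assumes "Factorial_Ring.prime p" and "group U" and "order U = p ^ n"
  shows
    \<comment> \<open>The solution exists and is given by a polynomial depending only on \<open>U\<close>.\<close>
    "(\<exists>P \<in> ncpolys_over (carrier U).
        \<forall>(R :: ('r, 'k) ring_scheme) \<phi> x \<beta>. cocycle_data U R \<phi> x \<beta> \<longrightarrow>
          splits_cocycle R \<phi> (carrier U) \<beta> (ncpoly_value R \<phi> x \<beta> P)) \<and>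
    \<comment> \<open>The choices in the procedure can be made.\<close>
     (n > 0 \<longrightarrow> (\<exists>c. admissible p U c)) \<and>
    \<comment> \<open>Every run of the procedure produces a polynomial solution.\<close>
     (\<forall>c. admissible p U c \<longrightarrow>
        (\<exists>P \<in> ncpolys_over (carrier U).
           \<forall>(R :: ('r, 'k) ring_scheme) \<phi> x \<beta>. cocycle_data U R \<phi> x \<beta> \<longrightarrow>
             procedure p U R \<phi> c x \<beta> = ncpoly_value R \<phi> x \<beta> P \<and>
             splits_cocycle R \<phi> (carrier U) \<beta> (procedure p U R \<phi> c x \<beta>))) \<and>
    \<comment> \<open>The recursive call on \<open>U'\<close> yields a suitable \<open>w\<^sub>1\<close>, polynomial in the \<open>u'(x')\<close> and \<open>u'(\<beta>(v'))\<close>.\<close>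
     (\<forall>U' \<sigma> c. admissible p U (Extend U' \<sigma> c) \<longrightarrow>
        (\<exists>P \<in> ncpolys_over U'.
           \<forall>(R :: ('r, 'k) ring_scheme) \<phi> x \<beta>. cocycle_data U R \<phi> x \<beta> \<longrightarrow>
             (let x' = geometric_action U R \<phi> \<sigma> p x;
                  w\<^sub>1 = procedure p (U\<lparr>carrier := U'\<rparr>) R \<phi> c x' \<beta>
              in w\<^sub>1 = ncpoly_value R \<phi> x' \<beta> P \<and> splits_cocycle R \<phi> U' \<beta> w\<^sub>1))) \<and>
    \<comment> \<open>The assertions made in the inductive step, for an arbitrary \<open>w\<^sub>1\<close> solving the problem on \<open>U'\<close>.\<close>
     (\<forall>U' \<sigma> (R :: ('r, 'k) ring_scheme) \<phi> x \<beta>.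
        index_p_extension p U U' \<sigma> \<longrightarrow> cocycle_data U R \<phi> x \<beta> \<longrightarrow>
        action_norm R \<phi> U' (geometric_action U R \<phi> \<sigma> p x) = \<one>\<^bsub>R\<^esub> \<and>
        (\<forall>w\<^sub>1. splits_cocycle R \<phi> U' \<beta> w\<^sub>1 \<longrightarrow>
          (let s' = \<beta> \<sigma> \<ominus>\<^bsub>R\<^esub> (\<phi> \<sigma> w\<^sub>1 \<ominus>\<^bsub>R\<^esub> w\<^sub>1);
               x'' = action_norm R \<phi> U' x;
               w\<^sub>2 = cyclic_solution p U R \<phi> \<sigma> x'' s'
           in s' \<in> action_invariants R \<phi> U' \<and>
              geometric_action U R \<phi> \<sigma> p s' = \<zero>\<^bsub>R\<^esub> \<and>
              x'' \<in> action_invariants R \<phi> U' \<and>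
              geometric_action U R \<phi> \<sigma> p x'' = \<one>\<^bsub>R\<^esub> \<and>
              w\<^sub>2 \<in> action_invariants R \<phi> U' \<and>
              s' = \<phi> \<sigma> w\<^sub>2 \<ominus>\<^bsub>R\<^esub> w\<^sub>2 \<and>
              splits_cocycle R \<phi> (carrier U) \<beta> (w\<^sub>1 \<oplus>\<^bsub>R\<^esub> w\<^sub>2))))"
proof -
  interpret U: group U by (rule assms(2))
  have p: "p > 0" using assms(1) by (simp add: prime_gt_0_nat)
  have fin: "finite (carrier U)" using assms(3) p U.order_gt_0_iff_finite by simp
  have choice: "n > 0 \<longrightarrow> (\<exists>c. admissible p U c)"
    using ex_admissible[OF assms(1,2)] assms(3) by (cases n) auto
  have run: "\<forall>c. admissible p U c \<longrightarrow>
        (\<exists>P \<in> ncpolys_over (carrier U).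
           \<forall>(R :: ('r, 'k) ring_scheme) \<phi> x \<beta>. cocycle_data U R \<phi> x \<beta> \<longrightarrow>
             procedure p U R \<phi> c x \<beta> = ncpoly_value R \<phi> x \<beta> P \<and>
             splits_cocycle R \<phi> (carrier U) \<beta> (procedure p U R \<phi> c x \<beta>))"
    using procedure_correct[OF p assms(2) fin] unfolding nc_expressible_def by metis
  have exists: "\<exists>P \<in> ncpolys_over (carrier U).
        \<forall>(R :: ('r, 'k) ring_scheme) \<phi> x \<beta>. cocycle_data U R \<phi> x \<beta> \<longrightarrow>
          splits_cocycle R \<phi> (carrier U) \<beta> (ncpoly_value R \<phi> x \<beta> P)"
  \<comment> \<open>For the trivial group there is no run to appeal to; the zero polynomial works
    because \<beta>(1) = 0.\<close>
  proof (cases "n = 0")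
    case False
    then obtain c where "admissible p U c" using choice by auto
    with run show ?thesis by (metis (no_types, lifting))
  next
    case True
    then have "card (carrier U) = 1" using assms(3) by (simp add: order_def)
    then have one: "carrier U = {\<one>\<^bsub>U\<^esub>}" using U.one_closed by (metis card_1_singletonE singletonD)
    have "splits_cocycle R \<phi> (carrier U) \<beta> (ncpoly_value R \<phi> x \<beta> 0)"
      if d: "cocycle_data U R \<phi> x \<beta>" for R :: "('r, 'k) ring_scheme" and \<phi> x \<beta>
    proof -
      interpret ring_action U R \<phi> by (rule cocycle_data_ring_action[OF assms(2) d])
      have "one_cocycle U R \<phi> \<beta>" using d by (simp add: cocycle_data_def)
      from cocycle_geometric[OF this U.one_closed, of 0] have "\<beta> \<one>\<^bsub>U\<^esub> = \<zero>\<^bsub>R\<^esub>"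
        by (simp add: geometric_action_def)
      then show ?thesis unfolding one by (simp add: splits_cocycle_def ncpoly_value_def a_minus_def)
    qed
    then show ?thesis by (intro bexI[of _ 0]) (auto simp: ncpolys_over_iff)
  qed
  have rec_call: "\<exists>P \<in> ncpolys_over U'.
           \<forall>(R :: ('r, 'k) ring_scheme) \<phi> x \<beta>. cocycle_data U R \<phi> x \<beta> \<longrightarrow>
             (let x' = geometric_action U R \<phi> \<sigma> p x;
                  w\<^sub>1 = procedure p (U\<lparr>carrier := U'\<rparr>) R \<phi> c x' \<beta>
              in w\<^sub>1 = ncpoly_value R \<phi> x' \<beta> P \<and> splits_cocycle R \<phi> U' \<beta> w\<^sub>1)"
    if "admissible p U (Extend U' \<sigma> c)" for U' \<sigma> c
  proof -
    have ext: "index_p_extension p U U' \<sigma>" and adm: "admissible p (U\<lparr>carrier := U'\<rparr>) c"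
      using that by auto
    then have U': "subgroup U' U" by (auto simp: index_p_extension_def normal_imp_subgroup)
    have "group (U\<lparr>carrier := U'\<rparr>)" "finite (carrier (U\<lparr>carrier := U'\<rparr>))"
      using U.subgroup_imp_group[OF U'] subgroup.subset[OF U'] fin by (auto intro: finite_subset)
    from procedure_correct[OF p this adm, where ?'r = 'r and ?'k = 'k] show ?thesis
      by (intro recursive_call_correct[OF assms(2) fin p ext]) auto
  qed
  have step: "action_norm R \<phi> U' (geometric_action U R \<phi> \<sigma> p x) = \<one>\<^bsub>R\<^esub> \<and>
        (\<forall>w\<^sub>1. splits_cocycle R \<phi> U' \<beta> w\<^sub>1 \<longrightarrow>
          (let s' = \<beta> \<sigma> \<ominus>\<^bsub>R\<^esub> (\<phi> \<sigma> w\<^sub>1 \<ominus>\<^bsub>R\<^esub> w\<^sub>1);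
               x'' = action_norm R \<phi> U' x;
               w\<^sub>2 = cyclic_solution p U R \<phi> \<sigma> x'' s'
           in s' \<in> action_invariants R \<phi> U' \<and>
              geometric_action U R \<phi> \<sigma> p s' = \<zero>\<^bsub>R\<^esub> \<and>
              x'' \<in> action_invariants R \<phi> U' \<and>
              geometric_action U R \<phi> \<sigma> p x'' = \<one>\<^bsub>R\<^esub> \<and>
              w\<^sub>2 \<in> action_invariants R \<phi> U' \<and>
              s' = \<phi> \<sigma> w\<^sub>2 \<ominus>\<^bsub>R\<^esub> w\<^sub>2 \<and>
              splits_cocycle R \<phi> (carrier U) \<beta> (w\<^sub>1 \<oplus>\<^bsub>R\<^esub> w\<^sub>2)))"
    if ext: "index_p_extension p U U' \<sigma>" and d: "cocycle_data U R \<phi> x \<beta>"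
    for U' \<sigma> and R :: "('r, 'k) ring_scheme" and \<phi> x \<beta>
  proof -
    interpret index_p_ring_action U R \<phi> p U' \<sigma>
      by (rule cocycle_data_index_p_ring_action[OF assms(2) fin p ext d])
    have x: "x \<in> carrier R" "action_norm R \<phi> (carrier U) x = \<one>\<^bsub>R\<^esub>" and \<beta>: "one_cocycle U R \<phi> \<beta>"
      using d by (auto simp: cocycle_data_def)
    show ?thesis
      unfolding Let_def
      by (intro conjI allI impI extension_step[OF \<beta> x]) (simp_all add: norm_geometric x)
  qed
  show ?thesis
    by (intro conjI exists choice run)
      ((intro allI impI, rule rec_call, assumption), intro allI impI, rule step)
qed

end
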